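(* For every integer $n\geq 10$, $$\varphi_{n}^{3}(2,1)=\binom{n-1}{2}-2,$$ where $\varphi_n^3(2,1)$ denotes the maximum number of arcs of a strong digraph on $n$ vertices that contains no directed cycle of length $2$ or $3$ and in which every vertex has out-degree at least $2$ and in-degree at least $1$.
   Context: All digraphs are finite and simple (no loops, no parallel arcs); $A(D)$ is the arc set of a digraph $D$. A digraph is strong (strongly connected) if every two vertices are mutually reachable by directed paths. A directed cycle of length $\ell$ is a list $y_0,\ldots,y_{\ell-1}$ of distinct vertices with arcs $(y_i,y_{i+1})$ for $0\le i\le \ell-2$ and $(y_{\ell-1},y_0)$. For $k\ge 2$, a digraph is $C_{\le k}$-free if it contains no directed cycle of length $\ell$ for any $\ell\in\{2,3,\ldots,k\}$ as a subdigraph. For positive integers $\xi,\zeta$, $D_n^k(\xi,\zeta)$ is the family of $C_{\le k}$-free strong digraphs on $n$ vertices in which every vertex has out-degree at least $\xi$ and in-degree at least $\zeta$, and $\varphi_n^k(\xi,\zeta)=\max\{|A(D)|: D\in D_n^k(\xi,\zeta)\}$, with the convention $\varphi_n^k(\xi,\zeta)=0$ if $D_n^k(\xi,\zeta)=\emptyset$. *)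

theory Defs
  imports "Graph_Theory.Graph_Theory"
begin

text \<open>
  A finite simple digraph is a \<^locale>\<open>pair_digraph\<close>: arcs are ordered pairs of vertices, so there
  are no parallel arcs, and loops are excluded, but opposite arcs (cycles of length 2) are allowed.
  A cycle is given by its list of arcs, so \<^term>\<open>length p\<close> is its length.
\<close>

definition dicycle_free_upto :: "nat \<Rightarrow> 'a pair_pre_digraph \<Rightarrow> bool" where
  "dicycle_free_upto k D \<longleftrightarrow>
     \<not> (\<exists>p. pre_digraph.cycle (with_proj D) p \<and> length p \<in> {2..k})"

text \<open>
  Vertices are drawn from \<^typ>\<open>nat\<close>, which contains an isomorphic copy of every finite digraph;
  the vertex set may be any set of \<open>n\<close> natural numbers.
\<close>

definition digraph_family :: "nat \<Rightarrow> nat \<Rightarrow> nat \<Rightarrow> nat \<Rightarrow> nat pair_pre_digraph set" where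
  "digraph_family n k \<xi> \<zeta> =
     {D. pair_digraph D \<and> card (pverts D) = n \<and> strongly_connected (with_proj D) \<and>
         dicycle_free_upto k D \<and>
         (\<forall>v \<in> pverts D. out_degree (with_proj D) v \<ge> \<xi> \<and> in_degree (with_proj D) v \<ge> \<zeta>)}"

definition max_arcs :: "nat \<Rightarrow> nat \<Rightarrow> nat \<Rightarrow> nat \<Rightarrow> nat" where
  "max_arcs n k \<xi> \<zeta> =
     (if digraph_family n k \<xi> \<zeta> = {} then 0
      else Max ((\<lambda>D. card (parcs D)) ` digraph_family n k \<xi> \<zeta>))"

text \<open>The maximum is taken over a finite set, so it is attained.\<close>

lemma finite_arc_counts: "finite ((\<lambda>D. card (parcs D)) ` digraph_family n k \<xi> \<zeta>)"
proof (rule finite_subset)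
  show "(\<lambda>D. card (parcs D)) ` digraph_family n k \<xi> \<zeta> \<subseteq> {..n * n}"
  proof (rule image_subsetI)
    fix D assume "D \<in> digraph_family n k \<xi> \<zeta>"
    then have D: "pair_digraph D" and n: "card (pverts D) = n"
      by (auto simp: digraph_family_def)
    interpret pair_digraph D by (fact D)
    have "parcs D \<subseteq> pverts D \<times> pverts D"
      using in_arcsD1 in_arcsD2 by auto
    then have "card (parcs D) \<le> card (pverts D \<times> pverts D)"
      by (intro card_mono) (auto simp: pair_finite_verts)
    then show "card (parcs D) \<in> {..n * n}"
      by (simp add: card_cartesian_product n)
  qed
qed simp

end

theory Submission
  imports Defs
begin

text \<open>
  Minimising the number of nonadjacent pairs is the same as maximising the number of arcs, so the
  upper bound says that there are at least \<open>n + 1\<close> of them. Every vertex has a nonneighbour, namely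
  at the end of a shortest path of length 2.

  If \<open>v\<close> has a single nonneighbour \<open>w\<close>, then \<open>v\<close>, its out-neighbours \<open>P\<close>, \<open>w\<close> and its in-neighbours
  \<open>Q\<close> form a cyclic pattern: \<open>P\<close> can be left only through \<open>w\<close>, \<open>Q\<close> can be entered only through \<open>w\<close>,
  and the in-neighbours of \<open>w\<close> in \<open>P\<close> are not adjacent to the out-neighbours of \<open>w\<close> in \<open>Q\<close>. The
  part of \<open>P\<close> that is reachable from \<open>w\<close> is again strong, with out-degrees at least 2 except perhaps
  at \<open>w\<close>; an induction over such rooted digraphs gives \<open>n + 1\<close> nonadjacent pairs.

  Otherwise every vertex has at least 2 nonneighbours, which gives \<open>n\<close> pairs, and equality forces
  exactly 2 nonneighbours everywhere. Then some vertex \<open>v\<close> has out-degree 2, and the arcs between its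
  out-neighbours, its nonneighbours and its in-neighbours are so constrained that \<open>n \<le> 9\<close>.
\<close>

section \<open>Nonadjacent pairs in oriented graphs without directed triangles\<close>

locale oriented =
  fixes E :: "'a \<Rightarrow> 'a \<Rightarrow> bool"
  assumes asym: "E x y \<Longrightarrow> \<not> E y x"
    and no_triangle: "E x y \<Longrightarrow> E y z \<Longrightarrow> \<not> E z x"
begin

definition nonadj :: "'a \<Rightarrow> 'a \<Rightarrow> bool" where
  "nonadj x y \<longleftrightarrow> x \<noteq> y \<and> \<not> E x y \<and> \<not> E y x"

definition gaps :: "'a set \<Rightarrow> 'a set \<Rightarrow> nat" where
  "gaps A B = (\<Sum>x\<in>A. card {y \<in> B. nonadj x y})"

text \<open>The sum \<open>gaps X X\<close> counts every nonadjacent pair inside \<open>X\<close> twice.\<close>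

definition gap :: "'a set \<Rightarrow> nat" where
  "gap X = gaps X X div 2"

definition out :: "'a set \<Rightarrow> 'a \<Rightarrow> nat" where
  "out X x = card {y \<in> X. E x y}"

text \<open>Strong connectivity of the induced digraph in cut form, since the arguments below all
  look for an arc leaving a suitable set. The empty set and singletons qualify, hence the side
  conditions \<open>X \<noteq> {x}\<close> later.\<close>

definition strong :: "'a set \<Rightarrow> bool" where
  "strong X \<longleftrightarrow> (\<forall>S. S \<subseteq> X \<and> S \<noteq> {} \<and> S \<noteq> X \<longrightarrow> (\<exists>x\<in>S. \<exists>y\<in>X - S. E x y))"

lemma irrefl: "\<not> E x x"
  using asym by blast

lemma nonadj_sym: "nonadj x y \<Longrightarrow> nonadj y x"
  by (auto simp: nonadj_def)

lemma nonadj_commute: "nonadj x y \<longleftrightarrow> nonadj y x"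
  by (auto simp: nonadj_def)

section \<open>Counting nonadjacent pairs\<close>

lemma gaps_union_right:
  assumes "finite B" "finite C" "B \<inter> C = {}"
  shows "gaps A (B \<union> C) = gaps A B + gaps A C"
proof -
  have "card {y \<in> B \<union> C. nonadj x y} = card {y \<in> B. nonadj x y} + card {y \<in> C. nonadj x y}" for x
    using assms by (subst card_Un_disjoint [symmetric]) (auto intro!: arg_cong[where f=card])
  then show ?thesis by (simp add: gaps_def sum.distrib)
qed

lemma gaps_union_left:
  assumes "finite A" "finite B" "A \<inter> B = {}"
  shows "gaps (A \<union> B) C = gaps A C + gaps B C"
  using assms by (simp add: gaps_def sum.union_disjoint)

lemma gaps_commute:
  assumes "finite A" "finite B"
  shows "gaps A B = gaps B A"
proof -
  have "gaps A B = (\<Sum>x\<in>A. \<Sum>y\<in>B. if nonadj x y then 1 else 0)"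
    using assms by (simp add: gaps_def sum.If_cases Int_def)
  also have "\<dots> = (\<Sum>y\<in>B. \<Sum>x\<in>A. if nonadj y x then 1 else 0)"
    by (subst sum.swap) (simp add: nonadj_commute)
  also have "\<dots> = gaps B A"
    using assms by (simp add: gaps_def sum.If_cases Int_def)
  finally show ?thesis .
qed

lemma gaps_union:
  assumes "finite A" "finite B" "A \<inter> B = {}"
  shows "gaps (A \<union> B) (A \<union> B) = gaps A A + gaps B B + 2 * gaps A B"
  using assms gaps_commute[of A B] by (simp add: gaps_union_left gaps_union_right)

text \<open>Makes the halving in \<open>gap\<close> exact.\<close>

lemma even_gaps:
  assumes "finite X"
  shows "even (gaps X X)"
  using assms
proof (induction X)
  case empty
  then show ?case by (simp add: gaps_def)
next
  case (insert x X)
  have "gaps {x} {x} = 0" by (simp add: gaps_def nonadj_def)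
  then show ?case using insert gaps_union[of "{x}" X] by simp
qed

lemma gap_double: "finite X \<Longrightarrow> 2 * gap X = (\<Sum>x\<in>X. card {y \<in> X. nonadj x y})"
  using even_gaps[of X] by (simp add: gap_def gaps_def)

lemma gap_union:
  assumes "finite A" "finite B" "A \<inter> B = {}"
  shows "gap (A \<union> B) = gap A + gap B + gaps A B"
  using gaps_union[OF assms] even_gaps[OF assms(1)] even_gaps[OF assms(2)]
  by (simp add: gap_def)

lemma gap_insert:
  assumes "finite A" "x \<notin> A"
  shows "gap (insert x A) = gap A + card {y \<in> A. nonadj x y}"
proof -
  have "gaps {x} {x} = 0" by (simp add: gaps_def nonadj_def)
  then have "gap {x} = 0" by (simp add: gap_def)
  then show ?thesis using gap_union[of "{x}" A] assms by (simp add: gaps_def)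
qed

lemma gaps_mono:
  assumes "A \<subseteq> A'" "B \<subseteq> B'" "finite A'" "finite B'"
  shows "gaps A B \<le> gaps A' B'"
proof -
  have "gaps A B \<le> gaps A B'"
    unfolding gaps_def using assms by (intro sum_mono card_mono) auto
  also have "\<dots> \<le> gaps A' B'"
    unfolding gaps_def using assms by (intro sum_mono2) auto
  finally show ?thesis .
qed

lemma gap_mono: "A \<subseteq> B \<Longrightarrow> finite B \<Longrightarrow> gap A \<le> gap B"
  unfolding gap_def by (intro div_le_mono gaps_mono)

text \<open>Charges one nonadjacent pair to each vertex of \<open>B\<close>; used for the vertices
  left over once a dense core has been handled.\<close>

lemma gaps_cover:
  assumes "finite A" "finite B" "\<And>b. b \<in> B \<Longrightarrow> \<exists>a\<in>A. nonadj a b"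
  shows "card B \<le> gaps A B"
proof -
  have "card B = (\<Sum>b\<in>B. 1)" by simp
  also have "\<dots> \<le> (\<Sum>b\<in>B. card {a \<in> A. nonadj b a})"
  proof (rule sum_mono)
    fix b assume "b \<in> B"
    then obtain a where "a \<in> A" "nonadj b a" using assms(3) nonadj_sym by blast
    then have "{a} \<subseteq> {a \<in> A. nonadj b a}" by auto
    then show "1 \<le> card {a \<in> A. nonadj b a}"
      using card_mono[of "{a \<in> A. nonadj b a}" "{a}"] assms(1) by simp
  qed
  also have "\<dots> = gaps A B" using assms gaps_commute[of A B] by (simp add: gaps_def)
  finally show ?thesis .
qed

lemma gaps_full:
  assumes "\<And>a b. a \<in> A \<Longrightarrow> b \<in> B \<Longrightarrow> nonadj a b"
  shows "gaps A B = card A * card B"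
proof -
  have "{y \<in> B. nonadj x y} = B" if "x \<in> A" for x using assms that by auto
  then show ?thesis by (simp add: gaps_def)
qed

section \<open>Strong sets, sinks and closed subsets\<close>

lemma strongD:
  assumes "strong X" "S \<subseteq> X" "S \<noteq> {}" "S \<noteq> X"
  obtains x y where "x \<in> S" "y \<in> X" "y \<notin> S" "E x y"
  using assms unfolding strong_def by blast

lemma strong_in_neighbour:
  assumes "strong X" "x \<in> X" "X \<noteq> {x}"
  obtains y where "y \<in> X" "E y x"
  using strongD[OF assms(1), of "X - {x}"] assms(2,3) by blast

text \<open>An in-neighbour of \<open>x\<close> lies outside \<open>x\<close> and its
  out-neighbours, so an arc \<open>u \<rightarrow> z\<close> leaves this set, with
  \<open>x \<rightarrow> u\<close>. An arc \<open>z \<rightarrow> x\<close> would close a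
  triangle.\<close>

lemma strong_second_neighbour:
  assumes "strong X" "x \<in> X" "X \<noteq> {x}"
  obtains z where "z \<in> X" "nonadj x z"
proof -
  obtain y where y: "y \<in> X" "E y x" using strong_in_neighbour[OF assms] .
  let ?S = "insert x {u \<in> X. E x u}"
  have "y \<notin> ?S" using y asym irrefl by blast
  then obtain u z where uz: "u \<in> ?S" "z \<in> X" "z \<notin> ?S" "E u z"
    using strongD[OF assms(1), of ?S] assms(2) y by blast
  then have "E x u" by auto
  then have "nonadj x z" using uz no_triangle unfolding nonadj_def by blast
  with uz show thesis using that by blast
qed

lemma strong_nonneighbour_ge1:
  assumes "finite X" "strong X" "x \<in> X" "X \<noteq> {x}"
  shows "1 \<le> card {y \<in> X. nonadj x y}"
proof -
  obtain z where "z \<in> X" "nonadj x z" using strong_second_neighbour[OF assms(2-)] .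
  then have "{z} \<subseteq> {y \<in> X. nonadj x y}" by auto
  then show ?thesis using card_mono[of "{y \<in> X. nonadj x y}" "{z}"] assms(1) by simp
qed

lemma strong_gap_ge:
  assumes "finite X" "strong X" "2 \<le> card X"
  shows "card X \<le> 2 * gap X"
proof -
  have "(\<Sum>x\<in>X. 1) \<le> (\<Sum>x\<in>X. card {y \<in> X. nonadj x y})"
    using assms by (intro sum_mono strong_nonneighbour_ge1) auto
  then show ?thesis using gap_double[OF assms(1)] by simp
qed

text \<open>Besides its out-neighbours, \<open>X\<close> contains \<open>x\<close> itself, an
  in-neighbour and a nonneighbour of \<open>x\<close>.\<close>

lemma strong_out_bound:
  assumes "finite X" "strong X" "x \<in> X" "X \<noteq> {x}"
  shows "out X x + 3 \<le> card X"
proof -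
  obtain y where y: "y \<in> X" "E y x" using strong_in_neighbour[OF assms(2-)] .
  obtain z where z: "z \<in> X" "nonadj x z" using strong_second_neighbour[OF assms(2-)] .
  let ?A = "{u \<in> X. E x u}"
  have "x \<notin> ?A" "y \<notin> insert x ?A" "z \<notin> insert y (insert x ?A)"
    using y z asym irrefl unfolding nonadj_def by blast+
  then have "card (insert z (insert y (insert x ?A))) = card ?A + 3"
    using assms(1) by simp
  moreover have "insert z (insert y (insert x ?A)) \<subseteq> X" using assms(3) y z by auto
  ultimately show ?thesis unfolding out_def using card_mono[OF assms(1)] by metis
qed

text \<open>A walk of three arcs in \<open>A\<close> has four distinct vertices, as 2-cycles and
  triangles are excluded. Contrapositively, a nonempty set of at most three vertices contains a
  sink.\<close>

lemma card_ge_4_if_out: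
  assumes "finite A" "A \<noteq> {}" "\<And>x. x \<in> A \<Longrightarrow> \<exists>y\<in>A. E x y"
  shows "4 \<le> card A"
proof -
  obtain a where a: "a \<in> A" using assms(2) by blast
  obtain b where b: "b \<in> A" "E a b" using assms(3)[OF a] by blast
  obtain c where c: "c \<in> A" "E b c" using assms(3)[OF b(1)] by blast
  obtain d where d: "d \<in> A" "E c d" using assms(3)[OF c(1)] by blast
  note abcd = a b c d
  have "a \<noteq> b" "a \<noteq> c" "a \<noteq> d" "b \<noteq> c" "b \<noteq> d" "c \<noteq> d"
    using abcd asym no_triangle by blast+
  then have "card {a,b,c,d} = 4" by simp
  moreover have "{a,b,c,d} \<subseteq> A" using abcd by simp
  ultimately show ?thesis using card_mono[OF assms(1)] by metis
qed

text \<open>A smallest nonempty subset that no arc of \<open>P\<close> leaves is a terminal strong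
  component of \<open>P\<close>.\<close>

lemma minimal_closed:
  assumes "finite P" "P \<noteq> {}"
  obtains X where "X \<subseteq> P" "X \<noteq> {}" "strong X" "\<forall>x\<in>X. \<forall>y\<in>P. E x y \<longrightarrow> y \<in> X"
proof -
  define F where "F X \<longleftrightarrow> X \<subseteq> P \<and> X \<noteq> {} \<and> (\<forall>x\<in>X. \<forall>y\<in>P. E x y \<longrightarrow> y \<in> X)" for X
  have "F P" using assms by (auto simp: F_def)
  then obtain X where X: "F X" "\<And>Y. F Y \<Longrightarrow> card X \<le> card Y"
    using ex_has_least_nat[of F P card] by blast
  have "strong X" unfolding strong_def
  proof (intro allI impI)
    fix S assume S: "S \<subseteq> X \<and> S \<noteq> {} \<and> S \<noteq> X"
    have "finite X" using X(1) assms(1) finite_subset unfolding F_def by blast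
    then have "card S < card X" using S psubset_card_mono by blast
    then have "\<not> F S" using X(2) by force
    then obtain x y where "x \<in> S" "y \<in> P" "E x y" "y \<notin> S"
      using S X(1) unfolding F_def by blast
    moreover have "y \<in> X" using calculation S X(1) unfolding F_def by blast
    ultimately show "\<exists>x\<in>S. \<exists>y\<in>X - S. E x y" by blast
  qed
  with X(1) show thesis using that unfolding F_def by blast
qed

text \<open>
  Grow a set from \<open>w\<close> and its out-neighbours one vertex at a time: by triangle-freeness, each further
  vertex has a nonneighbour among the vertices that precede it.
\<close>

lemma rooted_gap:
  assumes fin: "finite Q" and w: "w \<notin> Q"
    and enter: "\<And>S. S \<subseteq> Q \<Longrightarrow> S \<noteq> {} \<Longrightarrow> \<exists>x \<in> insert w Q - S. \<exists>y\<in>S. E x y"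
  shows "card Q \<le> gap (insert w Q) + card {q \<in> Q. E w q}"
proof -
  let ?Q1 = "{q \<in> Q. E w q}"
  define F where "F R \<longleftrightarrow> insert w ?Q1 \<subseteq> R \<and> R \<subseteq> insert w Q
     \<and> (\<forall>S. S \<subseteq> R - {w} \<and> S \<noteq> {} \<longrightarrow> (\<exists>x \<in> R - S. \<exists>y\<in>S. E x y))
     \<and> card R \<le> gap R + card ?Q1 + 1" for R
  have "F (insert w ?Q1)" unfolding F_def
    using w fin by auto
  moreover have "\<forall>R. F R \<longrightarrow> card R < card Q + 2"
  proof (intro allI impI)
    fix R assume "F R"
    then show "card R < card Q + 2"
      using w fin card_mono[of "insert w Q" R] by (simp add: F_def)
  qed
  ultimately obtain R where R: "F R" and max: "\<And>R'. F R' \<Longrightarrow> card R' \<le> card R"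
    using ex_has_greatest_nat[of F "insert w ?Q1" card "card Q + 2"] by blast
  have finR: "finite R" using R fin finite_subset unfolding F_def by blast
  have R_root: "\<exists>x \<in> R - S. \<exists>y\<in>S. E x y" if "S \<subseteq> R - {w}" "S \<noteq> {}" for S
    using R that unfolding F_def by simp
  have R_sub: "insert w ?Q1 \<subseteq> R" "R \<subseteq> insert w Q" "card R \<le> gap R + card ?Q1 + 1"
    using R unfolding F_def by auto
  have "R = insert w Q"
  proof (rule ccontr)
    assume "R \<noteq> insert w Q"
    then have "Q - R \<noteq> {}" using R_sub by blast
    then obtain x q where xq: "x \<in> insert w Q - (Q - R)" "q \<in> Q" "q \<notin> R" "E x q"
      using enter[of "Q - R"] by blast
    then have xR: "x \<in> R" using R_sub by blast
    \<comment> \<open>The set avoids \<open>w\<close>, so by the invariant some \<open>u\<close> in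
      \<open>R\<close> outside it has an arc into it. Then \<open>u\<close> lies two arcs before
      \<open>q\<close> and is not an in-neighbour of \<open>q\<close>, hence is nonadjacent to
      it.\<close>
    let ?Y = "{y \<in> R. E y q}"
    have "\<not> E w q" using xq R_sub by blast
    then have Y: "?Y \<subseteq> R - {w}" "?Y \<noteq> {}" using xR xq by blast+
    then obtain u y where uy: "u \<in> R - ?Y" "y \<in> ?Y" "E u y"
      using R_root[of ?Y] by blast
    then have "nonadj q u" using xq no_triangle unfolding nonadj_def by blast
    then have "{u} \<subseteq> {y \<in> R. nonadj q y}" using uy by auto
    then have "1 \<le> card {y \<in> R. nonadj q y}"
      using card_mono[of "{y \<in> R. nonadj q y}" "{u}"] finR by simp
    then have "card (insert q R) \<le> gap (insert q R) + card ?Q1 + 1"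
      using R_sub(3) gap_insert[OF finR xq(3)] finR xq(3) by simp
    moreover have "\<exists>x \<in> insert q R - S. \<exists>y\<in>S. E x y" if S: "S \<subseteq> insert q R - {w}" "S \<noteq> {}" for S
    proof (cases "S = {q}")
      case True
      then show ?thesis using xq xR by blast
    next
      case False
      then have "S - {q} \<subseteq> R - {w}" "S - {q} \<noteq> {}" using S by blast+
      then obtain x y where "x \<in> R - (S - {q})" "y \<in> S - {q}" "E x y"
        using R_root[of "S - {q}"] by blast
      then show ?thesis using xq(3) by blast
    qed
    moreover have "insert w ?Q1 \<subseteq> insert q R" "insert q R \<subseteq> insert w Q"
      using R_sub xq(2) by blast+
    ultimately have "F (insert q R)" unfolding F_def by blast
    then show False using max[of "insert q R"] finR xq(3) by simp
  qed
  then show ?thesis using R_sub(3) fin w by simp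
qed

section \<open>Strong sets with one vertex of small out-degree\<close>

text \<open>The root is the one vertex whose out-degree may fall below 2 when a closed piece is cut
  out of a larger digraph; admitting this exception keeps the class closed under the
  induction.\<close>

definition rooted_strong :: "'a set \<Rightarrow> 'a \<Rightarrow> bool" where
  "rooted_strong C w \<longleftrightarrow> finite C \<and> strong C \<and> w \<in> C \<and> 1 \<le> out C w \<and> (\<forall>x\<in>C - {w}. 2 \<le> out C x)"

lemma out_ge1: "finite X \<Longrightarrow> 1 \<le> out X x \<longleftrightarrow> (\<exists>y\<in>X. E x y)"
  unfolding out_def by (auto simp: Suc_le_eq card_gt_0_iff)

lemma out_mono:
  assumes "finite B" "\<And>y. y \<in> A \<Longrightarrow> E x y \<Longrightarrow> y \<in> B"
  shows "out A x \<le> out B x"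
  unfolding out_def using assms by (intro card_mono) auto

lemma out_remove:
  assumes "finite B" "\<And>y. y \<in> A \<Longrightarrow> E x y \<Longrightarrow> y \<in> B \<or> y = w"
  shows "out A x \<le> out B x + 1"
proof -
  have "out A x \<le> out (insert w B) x" using assms by (intro out_mono) auto
  also have "\<dots> \<le> card (insert w {y \<in> B. E x y})"
    unfolding out_def using assms(1) by (intro card_mono) auto
  also have "\<dots> \<le> out B x + 1"
    unfolding out_def using assms(1) by (simp add: card_insert_if)
  finally show ?thesis .
qed

text \<open>The hypotheses make \<open>Z\<close> exactly the out-neighbourhood of \<open>w\<close>
  in \<open>P\<close>; it is applied with a singleton and with the empty set.\<close>

lemma card_in_plus_nonneighbours:
  assumes "finite P" "\<And>y. y \<in> P - Z \<Longrightarrow> \<not> E w y" "w \<notin> P" "Z \<subseteq> P"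
    "\<And>y. y \<in> Z \<Longrightarrow> E w y"
  shows "card P = card {x \<in> P. E x w} + card {x \<in> P. nonadj w x} + card Z"
proof -
  have "P = {x \<in> P. E x w} \<union> ({x \<in> P. nonadj w x} \<union> Z)"
    using assms unfolding nonadj_def by blast
  moreover have "finite Z" using assms finite_subset by blast
  moreover have "{x \<in> P. nonadj w x} \<inter> Z = {}" "{x \<in> P. E x w} \<inter> ({x \<in> P. nonadj w x} \<union> Z) = {}"
    using assms(5) asym unfolding nonadj_def by blast+
  ultimately show ?thesis using assms(1) card_Un_disjoint
    by (metis (no_types, lifting) add.assoc finite_Un)
qed

text \<open>It suffices that the nonneighbour counts sum to at least 7. With four out-neighbours of
  \<open>c\<close>, already \<open>card X \<ge> 7\<close>. Otherwise a sink \<open>a\<close> among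
  them has two out-neighbours that are nonadjacent to \<open>c\<close>; then
  \<open>card X \<ge> 6\<close>, and \<open>c\<close> contributes one more than the minimum.\<close>

lemma gap_ge_4_if_out_ge_2:
  assumes fin: "finite X" and X: "strong X" and c: "c \<in> X" "2 \<le> out X c"
    and succ: "\<And>a. a \<in> X \<Longrightarrow> E c a \<Longrightarrow> 2 \<le> out X a"
  shows "4 \<le> gap X"
proof -
  let ?A = "{a \<in> X. E c a}"
  have ne: "X \<noteq> {x}" for x using c irrefl fin unfolding out_def
    by (metis (no_types, lifting) card.empty empty_Collect_eq not_numeral_le_zero singletonD)
  have X2: "2 \<le> card X" using c(2) card_mono[OF fin, of ?A] unfolding out_def by auto
  have "7 \<le> 2 * gap X"
  proof (cases "4 \<le> card ?A")
    case True
    then show ?thesis using strong_out_bound[OF fin X c(1) ne] strong_gap_ge[OF fin X X2]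
      unfolding out_def by linarith
  next
    case False
    have "?A \<noteq> {}" using c(2) unfolding out_def by (metis card.empty not_numeral_le_zero)
    then obtain a where a: "a \<in> ?A" "\<And>y. y \<in> ?A \<Longrightarrow> \<not> E a y"
      using False card_ge_4_if_out[of ?A] fin by auto
    let ?O = "{y \<in> X. E a y}"
    have O2: "2 \<le> card ?O" using a succ unfolding out_def by blast
    have ON: "?O \<subseteq> {y \<in> X. nonadj c y}"
      using a asym no_triangle unfolding nonadj_def by blast
    then have N2: "2 \<le> card {y \<in> X. nonadj c y}"
      using O2 card_mono[of "{y \<in> X. nonadj c y}" ?O] fin by simp
    obtain i where i: "i \<in> X" "E i c" using strong_in_neighbour[OF X c(1) ne] .
    have "c \<notin> ?A \<union> ?O" "i \<notin> insert c (?A \<union> ?O)" "?A \<inter> ?O = {}"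
      using i irrefl asym no_triangle a by blast+
    then have "card (insert i (insert c (?A \<union> ?O))) = card ?A + card ?O + 2"
      using fin by (simp add: card_Un_disjoint)
    moreover have "insert i (insert c (?A \<union> ?O)) \<subseteq> X" using i c by auto
    ultimately have "card ?A + card ?O + 2 \<le> card X" using card_mono[OF fin] by metis
    then have "6 \<le> card X" using O2 c(2) unfolding out_def by linarith
    have "card X + 1 = (card (X - {c})) + 2" using c fin by (simp add: card_Diff_singleton) (metis Suc_pred card_gt_0_iff empty_iff)
    also have "\<dots> \<le> (\<Sum>x\<in>X - {c}. card {y \<in> X. nonadj x y}) + card {y \<in> X. nonadj c y}"
    proof (rule add_mono[OF _ N2])
      have "(\<Sum>x\<in>X - {c}. 1) \<le> (\<Sum>x\<in>X - {c}. card {y \<in> X. nonadj x y})"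
        by (intro sum_mono strong_nonneighbour_ge1) (use fin X ne in auto)
      then show "card (X - {c}) \<le> (\<Sum>x\<in>X - {c}. card {y \<in> X. nonadj x y})" by simp
    qed
    also have "\<dots> = 2 * gap X"
      using gap_double[OF fin] sum.remove[OF fin c(1), of "\<lambda>x. card {y \<in> X. nonadj x y}"] by simp
    finally show ?thesis using \<open>6 \<le> card X\<close> by simp
  qed
  then show ?thesis by linarith
qed

text \<open>With at least five vertices, one nonneighbour each gives three pairs. With four
  vertices, \<open>strong_out_bound\<close> limits out-degrees inside \<open>X\<close> to 1, so
  every vertex must have an arc to \<open>w\<close>.\<close>

lemma strong_gap_ge_or_in:
  assumes fin: "finite X" and X: "strong X" "X \<noteq> {}"
    and o1: "\<And>x. x \<in> X \<Longrightarrow> 1 \<le> out X x"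
    and o2: "\<And>x. x \<in> X \<Longrightarrow> \<not> E x w \<Longrightarrow> 2 \<le> out X x"
  shows "3 \<le> gap X \<or> (2 \<le> gap X \<and> (\<forall>x\<in>X. E x w) \<and> 4 \<le> card X)"
proof -
  have X4: "4 \<le> card X"
    using card_ge_4_if_out[of X] fin X(2) o1 out_ge1[OF fin] by blast
  have ne: "X \<noteq> {x}" for x using X4 by auto
  have "E x w" if "card X = 4" "x \<in> X" for x
    using strong_out_bound[OF fin X(1) that(2) ne] o2[OF that(2)] that(1) by force
  moreover have "card X \<le> 2 * gap X" using strong_gap_ge[OF fin X(1)] X4 by simp
  ultimately show ?thesis using X4 by (cases "card X = 4") auto
qed

lemma closed_subset_exit:
  assumes "strong C" "w \<in> C" "X \<subseteq> C - {w}" "X \<noteq> {}"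
    "\<And>x y. x \<in> X \<Longrightarrow> y \<in> C - {w} \<Longrightarrow> E x y \<Longrightarrow> y \<in> X"
  shows "\<exists>x\<in>X. E x w"
proof -
  have "X \<subseteq> C" "X \<noteq> C" using assms(2,3) by blast+
  then obtain x y where "x \<in> X" "y \<in> C" "y \<notin> X" "E x y"
    using strongD[OF assms(1) _ assms(4)] by blast
  then show ?thesis using assms(5) by blast
qed

text \<open>Every vertex of \<open>C - {w}\<close> except the out-neighbour \<open>c\<close> is an
  in-neighbour or a nonneighbour of \<open>w\<close>, which reduces the claim to four nonadjacent
  pairs in \<open>C - {w}\<close>. These are found in a terminal component \<open>X\<close>,
  together with \<open>c\<close> if \<open>c \<notin> X\<close>.\<close>

lemma rooted_strong_gap_out1:
  assumes C: "rooted_strong C w" and out1: "out C w = 1"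
  shows "card C + 2 \<le> gap C + card {x \<in> C. E x w}"
proof -
  let ?P = "C - {w}"
  have fin: "finite C" and str: "strong C" and wC: "w \<in> C"
    and out2: "\<And>x. x \<in> ?P \<Longrightarrow> 2 \<le> out C x"
    using C unfolding rooted_strong_def by auto
  obtain c where "{y \<in> C. E w y} = {c}"
    using out1 card_1_singletonE unfolding out_def by blast
  then have c: "c \<in> ?P" "E w c" "\<And>y. y \<in> C \<Longrightarrow> E w y \<Longrightarrow> y = c"
    using irrefl by blast+
  obtain X where X: "X \<subseteq> ?P" "X \<noteq> {}" "strong X"
    and "\<forall>x\<in>X. \<forall>y\<in>?P. E x y \<longrightarrow> y \<in> X"
    using minimal_closed[of ?P] fin c(1) by (metis empty_iff finite_Diff)
  then have closed: "\<And>x y. x \<in> X \<Longrightarrow> y \<in> ?P \<Longrightarrow> E x y \<Longrightarrow> y \<in> X" by blast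
  have finX: "finite X" using X fin finite_subset by blast
  have exit: "\<exists>x\<in>X. E x w"
    using str wC X(1,2) closed by (rule closed_subset_exit)
  have o1: "1 \<le> out X x" if "x \<in> X" for x
  proof -
    have "out C x \<le> out X x + 1"
      by (rule out_remove[OF finX, of C x w]) (use closed[OF that] in blast)
    then show ?thesis using out2[of x] X(1) that by force
  qed
  have o2: "2 \<le> out X x" if "x \<in> X" "\<not> E x w" for x
  proof -
    have "out C x \<le> out X x"
      by (rule out_mono[OF finX]) (use closed[OF that(1)] that(2) in blast)
    then show ?thesis using out2[of x] X(1) that(1) by force
  qed
  have gap: "4 \<le> gap ?P"
  proof (cases "c \<in> X")
    case True
    \<comment> \<open>Neither \<open>c\<close> nor any out-neighbour of \<open>c\<close> has an arc
      to \<open>w\<close>, by asymmetry and triangle-freeness, so they keep out-degree 2 inside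
      \<open>X\<close>.\<close>
    have "4 \<le> gap X"
    proof (rule gap_ge_4_if_out_ge_2[OF finX X(3) True])
      show "2 \<le> out X c" using o2[OF True] c(2) asym by blast
      show "2 \<le> out X a" if "a \<in> X" "E c a" for a using o2[OF that(1)] no_triangle[OF c(2) that(2)] by blast
    qed
    then show ?thesis using gap_mono[OF X(1)] fin by (meson finite_Diff le_trans)
  next
    case False
    \<comment> \<open>Closedness of \<open>X\<close> forbids \<open>x \<rightarrow> c\<close>, and
      \<open>c \<rightarrow> x\<close> would close the triangle
      \<open>w \<rightarrow> c \<rightarrow> x \<rightarrow> w\<close>. So \<open>c\<close> adds one
      pair for each arc from \<open>X\<close> to \<open>w\<close>.\<close>
    have Nc: "nonadj c x" if "x \<in> X" "E x w" for x
      using that False c closed[OF that(1) c(1)] no_triangle unfolding nonadj_def by blast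
    have "gap (insert c X) = gap X + card {x \<in> X. nonadj c x}"
      using gap_insert[OF finX False] .
    moreover have "gap (insert c X) \<le> gap ?P" using X(1) c(1) fin by (intro gap_mono) auto
    moreover have "{x \<in> X. E x w} \<subseteq> {x \<in> X. nonadj c x}" using Nc by blast
    then have "card {x \<in> X. E x w} \<le> card {x \<in> X. nonadj c x}" using finX by (intro card_mono) auto
    moreover have "1 \<le> card {x \<in> X. E x w}"
      using finX exit by (auto simp: Suc_le_eq card_gt_0_iff)
    ultimately have ge: "gap X + card {x \<in> X. E x w} \<le> gap ?P" "1 \<le> card {x \<in> X. E x w}"
      by linarith+
    from strong_gap_ge_or_in[OF finX X(3,2) o1 o2] show ?thesis
    proof
      assume "3 \<le> gap X"
      then show ?thesis using ge by linarith
    next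
      assume a: "2 \<le> gap X \<and> (\<forall>x\<in>X. E x w) \<and> 4 \<le> card X"
      then have "{x \<in> X. E x w} = X" by blast
      then show ?thesis using ge a by simp
    qed
  qed
  have "card ?P = card {x \<in> ?P. E x w} + card {x \<in> ?P. nonadj w x} + card {c}"
  proof (rule card_in_plus_nonneighbours)
    show "\<not> E w y" if "y \<in> ?P - {c}" for y using that c(3) by blast
  qed (use fin c in blast)+
  moreover have "{x \<in> ?P. E x w} = {x \<in> C. E x w}" using irrefl by blast
  moreover have "gap C = gap ?P + card {x \<in> ?P. nonadj w x}"
    using gap_insert[of ?P w] fin wC by (simp add: insert_absorb)
  moreover have "card C = card ?P + 1" using fin wC by (metis card_Suc_Diff1 Suc_eq_plus1)
  ultimately show ?thesis using gap by simp
qed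

text \<open>A terminal component \<open>X\<close> of \<open>C - {w}\<close> must contain the only
  in-neighbour \<open>p\<close> of \<open>w\<close>, and is rooted at \<open>p\<close>. The
  in-neighbours of \<open>p\<close> in \<open>X\<close> are nonadjacent to \<open>w\<close>, so the
  correction term of the induction hypothesis becomes genuine pairs; each vertex outside
  \<open>insert w X\<close> is nonadjacent to \<open>p\<close> or to \<open>w\<close>.\<close>

lemma rooted_strong_gap_in1:
  assumes C: "rooted_strong C w" and in1: "card {x \<in> C. E x w} = 1"
    and IH: "\<And>C' w'. card C' < card C \<Longrightarrow> rooted_strong C' w' \<Longrightarrow>
      card C' + 2 \<le> gap C' + card {x \<in> C'. E x w'}"
  shows "card C + 1 \<le> gap C"
proof -
  let ?P = "C - {w}"
  have fin: "finite C" and str: "strong C" and wC: "w \<in> C"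
    and out2: "\<And>x. x \<in> ?P \<Longrightarrow> 2 \<le> out C x"
    using C unfolding rooted_strong_def by auto
  obtain p where "{x \<in> C. E x w} = {p}" using in1 card_1_singletonE by blast
  then have p: "p \<in> ?P" "E p w" "\<And>y. y \<in> C \<Longrightarrow> E y w \<Longrightarrow> y = p"
    using irrefl by blast+
  obtain X where X: "X \<subseteq> ?P" "X \<noteq> {}" "strong X"
    and "\<forall>x\<in>X. \<forall>y\<in>?P. E x y \<longrightarrow> y \<in> X"
    using minimal_closed[of ?P] fin p(1) by (metis empty_iff finite_Diff)
  then have closed: "\<And>x y. x \<in> X \<Longrightarrow> y \<in> ?P \<Longrightarrow> E x y \<Longrightarrow> y \<in> X" by blast
  have finX: "finite X" using X fin finite_subset by blast
  have "\<exists>x\<in>X. E x w"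
    using str wC X(1,2) closed by (rule closed_subset_exit)
  then have pX: "p \<in> X" using p(3) X(1) by blast
  have wX: "w \<notin> X" using X(1) by blast
  have "rooted_strong X p" unfolding rooted_strong_def
  proof (intro conjI ballI finX X(3) pX)
    have "out C p \<le> out X p + 1"
      by (rule out_remove[OF finX, of C p w]) (use closed[OF pX] in blast)
    then show "1 \<le> out X p" using out2[OF p(1)] by linarith
    fix x assume x: "x \<in> X - {p}"
    then have "\<not> E x w" using p(3) X(1) by blast
    then have "out C x \<le> out X x"
      by (intro out_mono[OF finX]) (use closed[of x] x in blast)
    then show "2 \<le> out X x" using out2[of x] X(1) x by force
  qed
  moreover have "card X < card C" using X(1) wC fin psubset_card_mono[of C X] by blast
  ultimately have IHX: "card X + 2 \<le> gap X + card {x \<in> X. E x p}" using IH by blast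
  let ?Y = "?P - X"
  have finY: "finite ?Y" using fin by blast
  have "{x \<in> X. E x p} \<subseteq> {x \<in> X. nonadj w x}"
    using p wX X(1) irrefl no_triangle unfolding nonadj_def by blast
  then have "card {x \<in> X. E x p} \<le> card {x \<in> X. nonadj w x}" using finX by (intro card_mono) auto
  then have "card X + 2 \<le> gap (insert w X)" using gap_insert[OF finX wX] IHX by simp
  moreover have "card ?Y \<le> gaps (insert w X) ?Y"
  proof (rule gaps_cover)
    fix b assume b: "b \<in> ?Y"
    have "\<not> E p b" using b closed[OF pX, of b] by blast
    moreover have "nonadj w b" if "E b p" using b that p pX no_triangle[OF that p(2)] unfolding nonadj_def by blast
    moreover have "p \<noteq> b" using pX b by blast
    ultimately have "nonadj w b \<or> nonadj p b" unfolding nonadj_def by blast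
    then show "\<exists>a\<in>insert w X. nonadj a b" using pX by blast
  qed (use fin finX in auto)
  moreover have "gap (insert w X \<union> ?Y) = gap (insert w X) + gap ?Y + gaps (insert w X) ?Y"
    using finX finY by (intro gap_union) auto
  moreover have C_eq: "C = insert w X \<union> ?Y" using X(1) wC by blast
  moreover have "card (insert w X \<union> ?Y) = card (insert w X) + card ?Y"
    using finX finY by (intro card_Un_disjoint) auto
  ultimately show ?thesis using finX wX by simp
qed

section \<open>A vertex with a single nonneighbour\<close>

text \<open>The statement proved by induction, named so that it can be assumed for proper subsets
  before it is established.\<close>

definition rooted_bound :: "'a set \<Rightarrow> bool" where
  "rooted_bound C \<longleftrightarrow> (\<forall>w. rooted_strong C w \<longrightarrow> card C + 2 \<le> gap C + card {x \<in> C. E x w})"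

lemma product_excess: "1 \<le> p \<Longrightarrow> 1 \<le> q \<Longrightarrow> p + q \<le> p * q + (1::nat)"
  by (cases p; cases q) auto

lemma product_excess_strict: "2 \<le> p \<Longrightarrow> 2 \<le> q \<Longrightarrow> p + q \<le> p * (q::nat)"
  using product_excess[of "p - 1" "q - 1"] by (cases p; cases q) auto

text \<open>The pairs split into \<open>{v, w}\<close>, those inside \<open>insert w P\<close>,
  those inside \<open>insert w Q\<close>, and those between \<open>P\<close> and \<open>Q\<close>.
  \<open>rooted_gap\<close> bounds the third kind; the fourth contains the product of
  \<open>?P1\<close> and \<open>?Q1\<close>. What remains is a bound for
  \<open>insert w P\<close>.\<close>

lemma gap_single_nonneighbour:
  assumes fin: "finite V" and V: "strong V" and out2: "\<And>x. x \<in> V \<Longrightarrow> 2 \<le> out V x"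
    and v: "v \<in> V" and Nv: "{y \<in> V. nonadj v y} = {w}"
    and IH: "\<And>C. C \<subset> V \<Longrightarrow> rooted_bound C"
  shows "card V + 1 \<le> gap V"
proof -
  define P where "P = {x \<in> V. E v x}"
  define Q where "Q = {x \<in> V. E x v}"
  let ?P1 = "{p \<in> P. E p w}" and ?Q1 = "{q \<in> Q. E w q}"
  have finPQ: "finite P" "finite Q" using fin by (auto simp: P_def Q_def)
  have w: "w \<in> V" "nonadj v w" using Nv by auto
  have vw: "v \<noteq> w" "w \<notin> P" "w \<notin> Q" "v \<notin> P" "v \<notin> Q"
    using w irrefl unfolding nonadj_def P_def Q_def by blast+
  have PQ_disj: "P \<inter> Q = {}" using asym unfolding P_def Q_def by blast
  have "x \<in> insert v (insert w (P \<union> Q))" if "x \<in> V" for x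
  proof (cases "nonadj v x")
    case True
    then show ?thesis using Nv that by blast
  next
    case False
    then show ?thesis using that unfolding P_def Q_def nonadj_def by blast
  qed
  moreover have "insert v (insert w (P \<union> Q)) \<subseteq> V" using v w unfolding P_def Q_def by blast
  ultimately have V_eq: "V = insert v (insert w (P \<union> Q))" by blast
  have PQ: "\<not> E p q" if "p \<in> P" "q \<in> Q" for p q
    using that no_triangle unfolding P_def Q_def by blast
  have outP: "y \<in> insert w P" if "p \<in> P" "y \<in> V" "E p y" for p y
  proof -
    have "y \<noteq> v" using that(1,3) asym unfolding P_def by blast
    then show ?thesis using that(2) V_eq PQ[OF that(1)] that(3) by blast
  qed
  have PV: "P \<subseteq> V" and QV: "Q \<subseteq> V" unfolding P_def Q_def by blast+
  have P_ne: "P \<noteq> {}" using out2[OF v] unfolding P_def out_def by (metis card.empty not_numeral_le_zero)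
  have "\<exists>p\<in>P. E p w"
  proof -
    have "P \<noteq> V" using v vw by blast
    then obtain x y where "x \<in> P" "y \<in> V" "y \<notin> P" "E x y"
      using strongD[OF V PV P_ne] by blast
    then show ?thesis using outP by blast
  qed
  then have P1: "1 \<le> card ?P1" using finPQ by (auto simp: Suc_le_eq card_gt_0_iff)
  have enterQ: "\<exists>x \<in> insert w Q - S. \<exists>y\<in>S. E x y" if S: "S \<subseteq> Q" "S \<noteq> {}" for S
  proof -
    have "V - S \<noteq> V" "V - S \<noteq> {}" using S v vw QV by blast+
    then obtain x y where "x \<in> V - S" "y \<in> V" "y \<notin> V - S" "E x y"
      using strongD[OF V Diff_subset] by metis
    then have xy: "x \<in> V" "x \<notin> S" "y \<in> S" "E x y" by blast+
    then have y: "y \<in> Q" "E y v" using S(1) unfolding Q_def by blast+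
    have "x \<noteq> v" using y(2) xy(4) asym by blast
    moreover have "x \<notin> P" using PQ y(1) xy(4) by blast
    ultimately have "x \<in> insert w Q - S" using xy(1,2) V_eq by blast
    then show ?thesis using xy(3,4) by blast
  qed
  have Q_gap: "card Q \<le> gap (insert w Q) + card ?Q1"
    using rooted_gap[OF finPQ(2) vw(3) enterQ] .
  have Q_ne: "Q \<noteq> {}"
    using strong_in_neighbour[OF V v] w vw(1) unfolding Q_def by blast
  have "\<exists>q\<in>Q. E w q" using enterQ[OF subset_refl Q_ne] by blast
  then have Q1: "1 \<le> card ?Q1" using finPQ by (auto simp: Suc_le_eq card_gt_0_iff)
  have "nonadj q p" if "p \<in> ?P1" "q \<in> ?Q1" for p q
    using that PQ[of p q] no_triangle[of p w q] PQ_disj unfolding nonadj_def by blast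
  then have "gaps ?Q1 ?P1 = card ?Q1 * card ?P1" by (intro gaps_full) auto
  moreover have "gaps ?Q1 ?P1 \<le> gaps Q P" using finPQ by (intro gaps_mono) auto
  ultimately have QP: "card ?Q1 * card ?P1 \<le> gaps Q P" by simp
  have gapwP: "gap (insert w P) = gap P + card {y \<in> P. nonadj w y}"
    using gap_insert[OF finPQ(1) vw(2)] .
  have "gap V = gap (insert w (P \<union> Q)) + 1"
  proof -
    have "{y \<in> insert w (P \<union> Q). nonadj v y} = {w}" using Nv w(2) P_def Q_def unfolding nonadj_def by auto
    then show ?thesis using gap_insert[of "insert w (P \<union> Q)" v] finPQ vw V_eq by simp
  qed
  also have "insert w (P \<union> Q) = insert w Q \<union> P" by blast
  also have "gap (insert w Q \<union> P) = gap (insert w Q) + gap P + gaps (insert w Q) P"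
    using finPQ vw PQ_disj by (intro gap_union) auto
  also have "gaps (insert w Q) P = card {y \<in> P. nonadj w y} + gaps Q P"
    using finPQ vw by (simp add: gaps_def)
  finally have gapV: "1 + gap (insert w P) + gap (insert w Q) + card ?Q1 * card ?P1 \<le> gap V"
    using gapwP QP by linarith
  have cardV: "card V = card P + card Q + 2"
    using V_eq finPQ vw PQ_disj by (simp add: card_Un_disjoint)
  \<comment> \<open>The terms \<open>- card ?P1\<close> and \<open>- card ?Q1\<close> are repaid by
    the product up to a loss of 1.\<close>
  have main: ?thesis if "card P + 3 \<le> gap (insert w P) + card ?P1"
    using that gapV cardV Q_gap product_excess[OF Q1 P1] by linarith
  show ?thesis
  proof (cases "\<exists>p\<in>P. E w p")
    case False
    have "out V w \<le> card ?Q1"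
    proof -
      have "{y \<in> V. E w y} \<subseteq> ?Q1"
      proof
        fix y assume y: "y \<in> {y \<in> V. E w y}"
        then have "y \<noteq> v" "y \<noteq> w" using w(2) irrefl unfolding nonadj_def by blast+
        then show "y \<in> ?Q1" using y False V_eq by blast
      qed
      then show ?thesis unfolding out_def using finPQ by (intro card_mono) auto
    qed
    then have Q2: "2 \<le> card ?Q1" using out2[OF w(1)] by simp
    \<comment> \<open>Hence \<open>gap (insert w P) + card ?P1 = gap P + card P\<close>, and
      \<open>main\<close> only asks for \<open>3 \<le> gap P\<close>.\<close>
    have P_eq: "card P = card ?P1 + card {y \<in> P. nonadj w y}"
      using card_in_plus_nonneighbours[of P "{}" w] False finPQ vw by simp
    obtain X where X: "X \<subseteq> P" "X \<noteq> {}" "strong X"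
      and "\<forall>x\<in>X. \<forall>y\<in>P. E x y \<longrightarrow> y \<in> X"
      using minimal_closed[OF finPQ(1) P_ne] .
    then have closed: "\<And>x y. x \<in> X \<Longrightarrow> y \<in> P \<Longrightarrow> E x y \<Longrightarrow> y \<in> X" by blast
    have finX: "finite X" using X finPQ finite_subset by blast
    have o1: "1 \<le> out X x" if "x \<in> X" for x
    proof -
      have "out V x \<le> out X x + 1"
      proof (rule out_remove[OF finX])
        fix y assume y: "y \<in> V" "E x y"
        have "x \<in> P" using X(1) that by blast
        then have "y \<in> insert w P" using outP y by simp
        then show "y \<in> X \<or> y = w" using closed[OF that _ y(2)] by auto
      qed
      moreover have "x \<in> V" using that X(1) PV by blast
      ultimately show ?thesis using out2[of x] by linarith
    qed
    have o2: "2 \<le> out X x" if "x \<in> X" "\<not> E x w" for x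
    proof -
      have "out V x \<le> out X x"
      proof (rule out_mono[OF finX])
        fix y assume y: "y \<in> V" "E x y"
        have "x \<in> P" using X(1) that(1) by blast
        then have "y \<in> insert w P" using outP y by simp
        then show "y \<in> X" using closed[OF that(1) _ y(2)] that(2) y(2) by auto
      qed
      moreover have "x \<in> V" using that X(1) PV by blast
      ultimately show ?thesis using out2[of x] by linarith
    qed
    have "gap X \<le> gap P" using gap_mono[OF X(1) finPQ(1)] .
    moreover have "4 \<le> card ?P1" if "\<forall>x\<in>X. E x w" "4 \<le> card X"
    proof -
      have "X \<subseteq> ?P1" using that X(1) by blast
      then show ?thesis using that card_mono[of ?P1 X] finPQ by force
    qed
    ultimately have "3 \<le> gap P \<or> (2 \<le> gap P \<and> 4 \<le> card ?P1)"
      using strong_gap_ge_or_in[OF finX X(3,2) o1 o2] le_trans by blast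
    then consider "3 \<le> gap P" | "2 \<le> gap P" "4 \<le> card ?P1" by blast
    then show ?thesis
    proof cases
      case 1
      then show ?thesis using gapwP P_eq by (intro main) simp
    next
      case 2
      \<comment> \<open>With both factors at least 2 the product loses nothing, which makes up for
        the third pair missing in \<open>P\<close>.\<close>
      then have "card ?Q1 + card ?P1 \<le> card ?Q1 * card ?P1"
        using product_excess_strict[OF Q2] by simp
      then show ?thesis using 2 gapwP P_eq gapV cardV Q_gap by linarith
    qed
  next
    case True
    \<comment> \<open>The smallest such \<open>S\<close> consists of the vertices of
      \<open>P\<close> reachable from \<open>w\<close> through \<open>P\<close>. Since
      \<open>P\<close> can be left only through \<open>w\<close>, adding \<open>w\<close> gives a
      strong set.\<close>
    define F where "F S \<longleftrightarrow> S \<subseteq> P \<and> (\<forall>x\<in>insert w S. \<forall>y\<in>P. E x y \<longrightarrow> y \<in> S)" for S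
    have "F P" by (auto simp: F_def)
    then obtain S where S: "F S" and min: "\<And>T. F T \<Longrightarrow> card S \<le> card T"
      using ex_has_least_nat[of F P card] by blast
    let ?C = "insert w S"
    have SP: "S \<subseteq> P" and Scl: "\<And>x y. x \<in> ?C \<Longrightarrow> y \<in> P \<Longrightarrow> E x y \<Longrightarrow> y \<in> S"
      using S unfolding F_def by blast+
    have finS: "finite S" and wS: "w \<notin> S" using SP finPQ finite_subset vw by blast+
    have "strong ?C" unfolding strong_def
    proof (intro allI impI)
      fix T assume T: "T \<subseteq> ?C \<and> T \<noteq> {} \<and> T \<noteq> ?C"
      show "\<exists>x\<in>T. \<exists>y\<in>?C - T. E x y"
      proof (cases "w \<in> T")
        case wT: True
        have "T - {w} \<subset> S" using T wT wS by blast
        then have "card (T - {w}) < card S" using finS psubset_card_mono by blast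
        then have "\<not> F (T - {w})" using min by force
        moreover have "T - {w} \<subseteq> P" "insert w (T - {w}) = T"
          using \<open>T - {w} \<subset> S\<close> SP wT by blast+
        ultimately obtain x y where "x \<in> T" "y \<in> P" "E x y" "y \<notin> T - {w}"
          unfolding F_def by auto
        moreover have "y \<noteq> w" using \<open>y \<in> P\<close> vw by blast
        ultimately show ?thesis using Scl[of x y] T by blast
      next
        case False
        have TS: "T \<subseteq> S" using T False by blast
        then have "T \<subseteq> V" "T \<noteq> V" using SP PV w(1) False by blast+
        then obtain x y where xy: "x \<in> T" "y \<in> V" "y \<notin> T" "E x y"
          using strongD[OF V] T by blast
        have "y \<in> insert w P" using outP[OF _ xy(2,4)] xy(1) TS SP by blast
        then have "y \<in> ?C" using Scl[OF _ _ xy(4)] xy(1) TS by auto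
        then show ?thesis using xy by blast
      qed
    qed
    moreover have "1 \<le> out ?C w" using True Scl finS out_ge1[of ?C w] by blast
    moreover have "2 \<le> out ?C x" if "x \<in> ?C - {w}" for x
    proof -
      have "x \<in> P" using that SP by blast
      then have "out V x \<le> out ?C x"
      proof (intro out_mono)
        fix y assume y: "y \<in> V" "E x y"
        then have "y \<in> insert w P" using outP \<open>x \<in> P\<close> by simp
        then show "y \<in> ?C" using Scl[OF _ _ y(2)] that by auto
      qed (use finS in simp)
      moreover have "x \<in> V" using \<open>x \<in> P\<close> PV by blast
      ultimately show ?thesis using out2[of x] by linarith
    qed
    ultimately have "rooted_strong ?C w" using finS unfolding rooted_strong_def by blast
    moreover have "?C \<subset> V"
    proof -
      have "?C \<subseteq> V" "v \<notin> ?C" using SP PV w(1) vw by blast+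
      then show ?thesis using v by blast
    qed
    ultimately have Cb: "card ?C + 2 \<le> gap ?C + card {x \<in> ?C. E x w}"
      using IH unfolding rooted_bound_def by blast
    \<comment> \<open>No vertex of \<open>?Y\<close> is an out-neighbour of \<open>w\<close>: those
      in \<open>?P1\<close> raise \<open>card ?P1\<close>, the others are nonadjacent to
      \<open>w\<close> and raise the gap.\<close>
    let ?Y = "P - S" and ?Y' = "P - S - ?P1"
    have wP: "insert w P = ?C \<union> ?Y" using SP by blast
    have "gap (?C \<union> ?Y) = gap ?C + gap ?Y + gaps ?C ?Y"
      using finPQ finS vw by (intro gap_union) auto
    moreover have "card ?Y' \<le> gaps ?C ?Y'"
    proof (rule gaps_cover)
      fix b assume "b \<in> ?Y'"
      then have "nonadj w b" using Scl[of w b] vw unfolding nonadj_def by blast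
      then show "\<exists>a\<in>?C. nonadj a b" by blast
    qed (use finPQ finS in auto)
    moreover have "gaps ?C ?Y' \<le> gaps ?C ?Y" using finPQ finS by (intro gaps_mono) auto
    ultimately have g: "gap ?C + card ?Y' \<le> gap (insert w P)" unfolding wP by linarith
    have P1_eq: "?P1 = {x \<in> ?C. E x w} \<union> (?Y \<inter> ?P1)" using SP irrefl by blast
    have "card ({x \<in> ?C. E x w} \<union> (?Y \<inter> ?P1)) = card {x \<in> ?C. E x w} + card (?Y \<inter> ?P1)"
      using finPQ finS vw by (intro card_Un_disjoint) auto
    then have P1_card: "card ?P1 = card {x \<in> ?C. E x w} + card (?Y \<inter> ?P1)"
      using P1_eq by argo
    have "card ?Y = card ?Y' + card (?Y \<inter> ?P1)"
    proof -
      have "card (?Y' \<union> (?Y \<inter> ?P1)) = card ?Y' + card (?Y \<inter> ?P1)"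
        using finPQ by (intro card_Un_disjoint) auto
      moreover have "?Y' \<union> (?Y \<inter> ?P1) = ?Y" by blast
      ultimately show ?thesis by argo
    qed
    moreover have "card P = card S + card ?Y"
      using SP finPQ finS card_mono[OF finPQ(1) SP] by (simp add: card_Diff_subset)
    ultimately show ?thesis using P1_card g Cb finS wS by (intro main) simp
  qed
qed

text \<open>A vertex with one nonneighbour is settled above; otherwise all counts are at least 2.
  The equality case is kept as structural information for the final contradiction.\<close>

lemma gap_ge_card:
  assumes fin: "finite V" and V: "strong V" "V \<noteq> {}" and out2: "\<And>x. x \<in> V \<Longrightarrow> 2 \<le> out V x"
    and IH: "\<And>C. C \<subset> V \<Longrightarrow> rooted_bound C"
  shows "card V + 1 \<le> gap V \<or> (gap V = card V \<and> (\<forall>v\<in>V. card {y \<in> V. nonadj v y} = 2))"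
proof (cases "\<exists>v\<in>V. card {y \<in> V. nonadj v y} = 1")
  case True
  then obtain v w where "v \<in> V" "{y \<in> V. nonadj v y} = {w}" by (meson card_1_singletonE)
  then show ?thesis using gap_single_nonneighbour[OF fin V(1) out2 _ _ IH] by blast
next
  case False
  have ne: "V \<noteq> {x}" for x
  proof
    assume "V = {x}"
    moreover from this have "\<exists>y\<in>V. E x y" using out2[of x] out_ge1[OF fin, of x] by simp
    ultimately show False using irrefl by blast
  qed
  have ge2: "2 \<le> card {y \<in> V. nonadj v y}" if "v \<in> V" for v
    using strong_nonneighbour_ge1[OF fin V(1) that ne] False that by force
  show ?thesis
  proof (cases "\<forall>v\<in>V. card {y \<in> V. nonadj v y} = 2")
    case True
    then have "2 * gap V = 2 * card V" using gap_double[OF fin] by simp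
    then show ?thesis using True by simp
  next
    case False
    then have "\<exists>v\<in>V. 2 < card {y \<in> V. nonadj v y}" using ge2 by force
    then have "(\<Sum>v\<in>V. 2) < (\<Sum>v\<in>V. card {y \<in> V. nonadj v y})"
      using ge2 fin by (intro sum_strict_mono_ex1) auto
    then show ?thesis using gap_double[OF fin] by simp
  qed
qed

text \<open>If neither degree of the root is 1, all out-degrees are at least 2, so
  \<open>gap C \<ge> card C\<close>, and the in-degree of the root supplies the missing 2.\<close>

lemma rooted_bound: "rooted_bound C"
proof (induction "card C" arbitrary: C rule: less_induct)
  case less
  show ?case unfolding rooted_bound_def
  proof (intro allI impI)
    fix w assume C: "rooted_strong C w"
    then have fin: "finite C" and str: "strong C" and wC: "w \<in> C" and o1: "1 \<le> out C w"
      and o2: "\<And>x. x \<in> C - {w} \<Longrightarrow> 2 \<le> out C x"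
      unfolding rooted_strong_def by auto
    show "card C + 2 \<le> gap C + card {x \<in> C. E x w}"
    proof (cases "out C w = 1")
      case True
      then show ?thesis using rooted_strong_gap_out1[OF C] by blast
    next
      case False
      have "C \<noteq> {w}" using o1 irrefl out_ge1[OF fin] by blast
      then obtain y where "y \<in> C" "E y w" using strong_in_neighbour[OF str wC] by blast
      then have in1: "1 \<le> card {x \<in> C. E x w}" using fin by (auto simp: Suc_le_eq card_gt_0_iff)
      show ?thesis
      proof (cases "card {x \<in> C. E x w} = 1")
        case True
        then show ?thesis using rooted_strong_gap_in1[OF C True] less.hyps
          unfolding rooted_bound_def by simp
      next
        case in2: False
        have "rooted_bound C'" if "C' \<subset> C" for C'
          using less.hyps[of C'] psubset_card_mono[OF fin that] by blast
        moreover have "2 \<le> out C x" if "x \<in> C" for x using that o1 o2 False by (cases "x = w") auto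
        ultimately have "card C \<le> gap C" using gap_ge_card[OF fin str] wC by fastforce
        then show ?thesis using in1 in2 by linarith
      qed
    qed
  qed
qed

section \<open>All vertices have exactly two nonneighbours\<close>

lemma sink_if_card_less_4:
  assumes "finite A" "A \<noteq> {}" "card A < 4"
  obtains a where "a \<in> A" "\<forall>y\<in>A. \<not> E a y"
  using card_ge_4_if_out[of A] assms by force

text \<open>Let \<open>v\<close> have minimum out-degree \<open>d\<close>. Out-neighbours of
  \<open>p \<in> P\<close> lie in \<open>P\<close> or among the two nonneighbours of
  \<open>v\<close>, so \<open>d * d\<close> is at most the number of arcs in \<open>P\<close> plus
  \<open>2 * d\<close>. As \<open>P\<close> spans at most \<open>d * (d - 1) / 2\<close> arcs,
  \<open>d \<le> 3\<close>; then a sink of \<open>P\<close> has out-degree at most 2.\<close>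

lemma min_out_eq_2:
  assumes fin: "finite V" and V: "V \<noteq> {}" and out2: "\<And>x. x \<in> V \<Longrightarrow> 2 \<le> out V x"
    and N2: "\<And>v. v \<in> V \<Longrightarrow> card {y \<in> V. nonadj v y} = 2"
  obtains v where "v \<in> V" "out V v = 2"
proof -
  obtain v where v: "v \<in> V" and min: "\<And>x. x \<in> V \<Longrightarrow> out V v \<le> out V x"
    using ex_has_least_nat[of "\<lambda>v. v \<in> V" _ "out V"] V by (metis ex_in_conv)
  define P where "P = {p \<in> V. E v p}"
  have finP: "finite P" using fin P_def by simp
  have cardP: "card P = out V v" by (simp add: P_def out_def)
  have out_le: "out V p \<le> out P p + 2" if "p \<in> P" for p
  proof -
    have "{y \<in> V. E p y} \<subseteq> {y \<in> P. E p y} \<union> {y \<in> V. nonadj v y}"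
      using that asym no_triangle unfolding nonadj_def P_def by blast
    then have "out V p \<le> card ({y \<in> P. E p y} \<union> {y \<in> V. nonadj v y})"
      unfolding out_def using fin finP by (intro card_mono) auto
    also have "\<dots> \<le> out P p + 2"
      using card_Un_le[of "{y \<in> P. E p y}" "{y \<in> V. nonadj v y}"] N2[OF v] unfolding out_def by simp
    finally show ?thesis .
  qed
  have arcs_le: "2 * (\<Sum>p\<in>P. out P p) \<le> card P * (card P - 1)"
  proof -
    let ?A = "Sigma P (\<lambda>p. {y \<in> P. E p y})"
    have A: "card ?A = (\<Sum>p\<in>P. out P p)" using finP by (simp add: out_def)
    have finA: "finite ?A" using finP by simp
    have "?A \<inter> ?A\<inverse> = {}" using asym by blast
    then have "card (?A \<union> ?A\<inverse>) = card ?A + card (?A\<inverse>)"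
      using finA by (intro card_Un_disjoint) auto
    moreover have "?A \<union> ?A\<inverse> \<subseteq> Sigma P (\<lambda>p. P - {p})" using irrefl by blast
    then have "card (?A \<union> ?A\<inverse>) \<le> card (Sigma P (\<lambda>p. P - {p}))"
      using finP by (intro card_mono) auto
    moreover have "card (Sigma P (\<lambda>p. P - {p})) = card P * (card P - 1)"
      using finP by simp
    ultimately show ?thesis using A by simp
  qed
  have "(\<Sum>p\<in>P. card P) \<le> (\<Sum>p\<in>P. out P p + 2)"
  proof (rule sum_mono)
    fix p assume "p \<in> P"
    moreover from this have "p \<in> V" unfolding P_def by blast
    ultimately show "card P \<le> out P p + 2" using out_le[of p] min[of p] cardP by simp
  qed
  then have "card P * card P \<le> (\<Sum>p\<in>P. out P p) + 2 * card P"
    by (simp only: sum.distrib sum_constant mult.commute) simp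
  then have "2 * (card P * card P) \<le> card P * (card P - 1) + 4 * card P"
    using arcs_le by linarith
  also have "\<dots> = card P * (card P + 3)"
    by (cases "card P") (auto simp: algebra_simps)
  finally have "card P * (2 * card P) \<le> card P * (card P + 3)" by (simp add: algebra_simps)
  moreover have P2: "2 \<le> card P" using out2[OF v] cardP by simp
  ultimately have "card P < 4" by simp
  moreover have "P \<noteq> {}" using P2 by auto
  ultimately obtain p where p: "p \<in> P" "\<forall>y\<in>P. \<not> E p y"
    using sink_if_card_less_4[OF finP] by blast
  then have "{y \<in> P. E p y} = {}" by blast
  then have "out P p = 0" unfolding out_def by (metis card.empty)
  moreover have "p \<in> V" using p(1) unfolding P_def by blast
  ultimately have "out V v \<le> 2" using out_le[OF p(1)] min[of p] by simp
  then show thesis using that[OF v] out2[OF v] by simp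
qed

end

text \<open>The equality case of \<open>gap_ge_card\<close>, with at least ten vertices; the aim is
  to derive \<open>False\<close> inside it.\<close>

locale two_gap_oriented = oriented +
  fixes V :: "'a set"
  assumes fin: "finite V" and str: "strong V" and V10: "10 \<le> card V"
    and N2: "\<And>v. v \<in> V \<Longrightarrow> card {y \<in> V. nonadj v y} = 2"
    and out2: "\<And>v. v \<in> V \<Longrightarrow> 2 \<le> out V v"
begin

lemma N_eq:
  assumes "u \<in> V" "s \<in> V" "t \<in> V" "nonadj u s" "nonadj u t" "s \<noteq> t" "y \<in> V" "nonadj u y"
  shows "y = s \<or> y = t"
proof -
  have "{s, t} \<subseteq> {y \<in> V. nonadj u y}" using assms by auto
  then have "{y \<in> V. nonadj u y} = {s, t}"
    using N2[OF assms(1)] card_subset_eq[of "{y \<in> V. nonadj u y}" "{s,t}"] fin assms(6) by simp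
  then show ?thesis using assms(7,8) by blast
qed

lemma adjacent:
  assumes "u \<in> V" "s \<in> V" "t \<in> V" "nonadj u s" "nonadj u t" "s \<noteq> t" "y \<in> V" "y \<noteq> u" "y \<noteq> s" "y \<noteq> t"
  shows "E u y \<or> E y u"
  using N_eq[OF assms(1-7)] assms(8-10) unfolding nonadj_def by blast

text \<open>
  Here \<open>a\<close> and \<open>b\<close> are the only out-neighbours of \<open>v\<close>, and the nonneighbours \<open>x\<close> and \<open>y\<close> of \<open>v\<close> are the
  only out-neighbours of \<open>a\<close>. All other vertices are in-neighbours of \<open>v\<close>; they are split into \<open>Q1\<close>
  (entered from \<open>x\<close> or \<open>y\<close>), \<open>R\<close> (with arcs to both) and the rest \<open>Z\<close>. Since \<open>Q1\<close> and \<open>Z\<close> have at most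
  two elements each, \<open>n \<ge> 10\<close> makes \<open>R\<close> nonempty, and \<open>R\<close> can be reached only by way of \<open>Q1\<close> and \<open>Z\<close>.
\<close>

definition setting :: "'a \<Rightarrow> 'a \<Rightarrow> 'a \<Rightarrow> 'a \<Rightarrow> 'a \<Rightarrow> bool" where
  "setting v a b x y \<longleftrightarrow> v \<in> V \<and> a \<in> V \<and> b \<in> V \<and> x \<in> V \<and> y \<in> V \<and>
     E v a \<and> E v b \<and> E a x \<and> E a y \<and> nonadj v x \<and> nonadj v y \<and> x \<noteq> y \<and> a \<noteq> b \<and>
     (\<forall>z\<in>V. E v z \<longrightarrow> z = a \<or> z = b) \<and> (\<forall>z\<in>V. E a z \<longrightarrow> z = x \<or> z = y)"

text \<open>The symmetry that later allows a vertex of \<open>Z\<close> to be taken nonadjacent to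
  \<open>x\<close>.\<close>

lemma setting_swap: "setting v a b x y \<Longrightarrow> setting v a b y x"
  unfolding setting_def by auto

definition Q where "Q v = {q \<in> V. E q v}"
definition Q1 where "Q1 v x y = {q \<in> V. E q v \<and> (E x q \<or> E y q)}"
definition R where "R v x y = {q \<in> V. E q v \<and> E q x \<and> E q y}"
definition Z where "Z v x y = Q v - Q1 v x y - R v x y"

lemma Q1_swap: "Q1 v y x = Q1 v x y" by (auto simp: Q1_def)
lemma R_swap: "R v y x = R v x y" by (auto simp: R_def)
lemma Z_swap: "Z v y x = Z v x y" by (simp add: Z_def Q1_swap R_swap)

text \<open>Take \<open>v\<close> of out-degree 2 and \<open>a\<close> a sink of its two
  out-neighbours. The out-neighbours of \<open>a\<close> are nonneighbours of \<open>v\<close>;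
  there are at least two of the former and exactly two of the latter.\<close>

lemma exists_setting: "\<exists>v a b x y. setting v a b x y"
proof -
  have "V \<noteq> {}" using V10 by auto
  then obtain v where v: "v \<in> V" "out V v = 2"
    using min_out_eq_2[OF fin] out2 N2 by metis
  let ?P = "{p \<in> V. E v p}"
  have P2: "card ?P = 2" using v(2) unfolding out_def .
  then have "?P \<noteq> {}" by (metis card.empty zero_neq_numeral)
  then obtain a where a: "a \<in> ?P" "\<forall>y\<in>?P. \<not> E a y"
  proof (rule sink_if_card_less_4[rotated])
    show "card ?P < 4" "finite ?P" using P2 fin by simp_all
  qed
  obtain c d where cd: "?P = {c, d}" "c \<noteq> d" using P2 by (meson card_2_iff)
  obtain b where b: "?P = {a, b}" "a \<noteq> b"
  proof (cases "a = c")
    case True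
    then show thesis using cd that[of d] by blast
  next
    case False
    then have "a = d" using cd(1) a(1) by blast
    then show thesis using cd that[of c] by blast
  qed
  have av: "a \<in> V" "E v a" using a(1) by blast+
  have "y \<in> {y \<in> V. nonadj v y}" if "y \<in> V" "E a y" for y
  proof -
    have "\<not> E v y" using a(2) that by blast
    moreover have "\<not> E y v" using av(2) that(2) no_triangle by blast
    moreover have "v \<noteq> y" using av(2) that(2) asym by blast
    ultimately show ?thesis using that(1) unfolding nonadj_def by blast
  qed
  then have sub: "{y \<in> V. E a y} \<subseteq> {y \<in> V. nonadj v y}" by blast
  have "{y \<in> V. E a y} = {y \<in> V. nonadj v y}"
    using fin N2[OF v(1)] out2[OF av(1)] unfolding out_def by (intro card_seteq[OF _ sub]) simp_all
  moreover obtain x y where xy: "{y \<in> V. nonadj v y} = {x, y}" "x \<noteq> y"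
    using N2[OF v(1)] by (meson card_2_iff)
  ultimately have axy: "{y \<in> V. E a y} = {x, y}" by simp
  have "x \<in> V" "y \<in> V" "E a x" "E a y" using axy by blast+
  moreover have "nonadj v x" "nonadj v y" using xy(1) by blast+
  moreover have "b \<in> V" "E v b" using b(1) by blast+
  moreover have "z = a \<or> z = b" if "z \<in> V" "E v z" for z using b(1) that by blast
  moreover have "z = x \<or> z = y" if "z \<in> V" "E a z" for z using axy that by blast
  ultimately have "setting v a b x y" unfolding setting_def using v(1) av b(2) xy(2) by simp
  then show ?thesis by blast
qed

section \<open>Structure of the in-neighbourhood of \<open>v\<close>\<close>

context
  fixes v a b x y
  assumes S: "setting v a b x y"
begin

lemma mem: "v \<in> V" "a \<in> V" "b \<in> V" "x \<in> V" "y \<in> V" "x \<noteq> y" "a \<noteq> b"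
  and arcs: "E v a" "E v b" "E a x" "E a y" "nonadj v x" "nonadj v y" "nonadj x v" "nonadj y v"
  and out_v: "\<And>z. z \<in> V \<Longrightarrow> E v z \<Longrightarrow> z = a \<or> z = b"
  and out_a: "\<And>z. z \<in> V \<Longrightarrow> E a z \<Longrightarrow> z = x \<or> z = y"
  using S nonadj_sym unfolding setting_def by blast+

lemma distinct_setting: "v \<noteq> a" "v \<noteq> b" "v \<noteq> x" "v \<noteq> y" "a \<noteq> x" "a \<noteq> y"  "b \<noteq> x" "b \<noteq> y"
  using arcs irrefl unfolding nonadj_def by blast+

lemma V_eq: "V = {v, a, b, x, y} \<union> Q v"
proof -
  have "z \<in> {v, a, b, x, y} \<union> Q v" if "z \<in> V" for z
  proof (cases "nonadj v z")
    case True
    then show ?thesis using N_eq[OF mem(1,4,5) arcs(5,6) mem(6) that] by blast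
  next
    case False
    then show ?thesis using out_v[OF that] that unfolding nonadj_def Q_def by blast
  qed
  moreover have "{v, a, b, x, y} \<union> Q v \<subseteq> V" using mem unfolding Q_def by blast
  ultimately show ?thesis by blast
qed

lemma Q_new: "q \<in> Q v \<Longrightarrow> q \<noteq> v \<and> q \<noteq> a \<and> q \<noteq> b \<and> q \<noteq> x \<and> q \<noteq> y"
  using arcs irrefl asym unfolding Q_def nonadj_def by blast

lemma card_V: "card V = card (Q v) + 5"
proof -
  have "card ({v, a, b, x, y} \<union> Q v) = card {v, a, b, x, y} + card (Q v)"
    using fin Q_new by (intro card_Un_disjoint) (auto simp: Q_def)
  then show ?thesis using V_eq mem distinct_setting by simp
qed

lemma Q_cases: "q \<in> Q v \<Longrightarrow> q \<in> Q1 v x y \<or> q \<in> R v x y \<or> q \<in> Z v x y"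
  unfolding Z_def by blast

lemma Q1_D: "q \<in> Q1 v x y \<Longrightarrow> q \<in> V \<and> E q v \<and> (E x q \<or> E y q) \<and> q \<in> Q v"
  unfolding Q1_def Q_def by blast

lemma R_D: "q \<in> R v x y \<Longrightarrow> q \<in> V \<and> E q v \<and> E q x \<and> E q y \<and> q \<in> Q v"
  unfolding R_def Q_def by blast

lemma Z_D: "q \<in> Z v x y \<Longrightarrow> q \<in> V \<and> E q v \<and> \<not> E x q \<and> \<not> E y q \<and> q \<in> Q v \<and> (nonadj x q \<or> nonadj y q)"
  unfolding Z_def Q1_def R_def Q_def using arcs nonadj_def by blast

text \<open>An arc \<open>q \<rightarrow> a\<close> would close a triangle through \<open>x\<close>
  or \<open>y\<close>, and \<open>x\<close>, \<open>y\<close> are the only out-neighbours of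
  \<open>a\<close>.\<close>

lemma Q1_Na: "q \<in> Q1 v x y \<Longrightarrow> nonadj a q"
  using Q1_D[of q] Q_new[of q] out_a[of q] arcs(3,4) no_triangle unfolding nonadj_def by blast

lemma R_not_from_Q1: "q \<in> Q1 v x y \<Longrightarrow> r \<in> R v x y \<Longrightarrow> \<not> E q r"
  using Q1_D[of q] R_D[of r] no_triangle by blast

lemma b_no_Q: "q \<in> Q v \<Longrightarrow> \<not> E b q"
  using arcs(2) no_triangle unfolding Q_def by blast

lemma finite_parts: "finite (Q v)" "finite (Q1 v x y)" "finite (R v x y)" "finite (Z v x y)"
  using fin unfolding Z_def Q_def Q1_def R_def by auto

text \<open>None of \<open>v\<close>, \<open>a\<close>, \<open>b\<close> has an arc into
  \<open>Q v\<close>.\<close>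

lemma enter:
  assumes "S \<subseteq> Q v" "S \<noteq> {}"
  obtains u s where "u \<in> V" "u \<notin> S" "s \<in> S" "E u s" "u = x \<or> u = y \<or> u \<in> Q v"
proof -
  have "V - S \<subseteq> V" "V - S \<noteq> {}" "V - S \<noteq> V"
    using assms mem(1) Q_new V_eq by blast+
  then obtain u s where us: "u \<in> V - S" "s \<in> V" "s \<notin> V - S" "E u s"
    by (rule strongD[OF str])
  have sQ: "s \<in> Q v" using us assms by blast
  have "u \<noteq> v" using sQ us(4) asym unfolding Q_def by blast
  moreover have "u \<noteq> a" using out_a[OF us(2)] us(4) Q_new[OF sQ] by blast
  moreover have "u \<noteq> b" using b_no_Q[OF sQ] us(4) by blast
  ultimately have "u = x \<or> u = y \<or> u \<in> Q v" using us(1) V_eq by blast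
  then show thesis using that us by blast
qed

lemma card_Q1: "card (Q1 v x y) \<le> 2"
proof -
  have "Q1 v x y \<subseteq> {q \<in> V. nonadj a q}" using Q1_Na Q1_D by blast
  then show ?thesis using card_mono[of "{q \<in> V. nonadj a q}" "Q1 v x y"] fin N2[OF mem(2)] by simp
qed

text \<open>Meant for \<open>u = x\<close> and \<open>u = y\<close>: \<open>v\<close> already takes
  one of the two nonneighbours.\<close>

lemma N_x_le1:
  assumes "nonadj u v" "u \<in> V"
  shows "card {z \<in> Q v. nonadj u z} \<le> 1"
proof -
  have "insert v {z \<in> Q v. nonadj u z} \<subseteq> {z \<in> V. nonadj u z}" using assms mem(1) unfolding Q_def by blast
  then have "card (insert v {z \<in> Q v. nonadj u z}) \<le> 2"
    using card_mono[of "{q \<in> V. nonadj u q}"] fin N2[OF assms(2)] by fastforce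
  moreover have "v \<notin> {z \<in> Q v. nonadj u z}" using Q_new by blast
  ultimately show ?thesis using finite_parts by simp
qed

lemma card_Z: "card (Z v x y) \<le> 2"
proof -
  have "Z v x y \<subseteq> {z \<in> Q v. nonadj x z} \<union> {z \<in> Q v. nonadj y z}" using Z_D by blast
  then have "card (Z v x y) \<le> card ({z \<in> Q v. nonadj x z} \<union> {z \<in> Q v. nonadj y z})"
    using finite_parts by (intro card_mono) auto
  also have "\<dots> \<le> card {z \<in> Q v. nonadj x z} + card {z \<in> Q v. nonadj y z}" by (rule card_Un_le)
  also have "\<dots> \<le> 2" using N_x_le1[OF arcs(7) mem(4)] N_x_le1[OF arcs(8) mem(5)] by simp
  finally show ?thesis .
qed

lemma card_parts: "5 \<le> card (Q1 v x y) + card (R v x y) + card (Z v x y)"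
proof -
  have "Q v = Q1 v x y \<union> R v x y \<union> Z v x y"
    using Q_cases Q1_D R_D Z_D by blast
  then have "card (Q v) \<le> card (Q1 v x y) + card (R v x y) + card (Z v x y)"
    using card_Un_le[of "Q1 v x y \<union> R v x y" "Z v x y"] card_Un_le[of "Q1 v x y" "R v x y"] by simp
  then show ?thesis using card_V V10 by simp
qed

lemma R_entry:
  assumes "T \<subseteq> R v x y" "T \<noteq> {}"
  shows "\<exists>z r. (z \<in> Z v x y \<or> z \<in> R v x y - T) \<and> r \<in> T \<and> E z r"
proof -
  have "T \<subseteq> Q v" using assms R_D by blast
  then obtain u r where ur: "u \<in> V" "u \<notin> T" "r \<in> T" "E u r" "u = x \<or> u = y \<or> u \<in> Q v"
    using assms(2) by (rule enter)
  have "r \<in> R v x y" using ur assms by blast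
  then have "E r x" "E r y" "u \<notin> Q1 v x y" using R_D R_not_from_Q1 ur(4) by blast+
  then have "u \<in> Z v x y \<or> u \<in> R v x y - T" using ur asym Q_cases by blast
  then show ?thesis using ur(3,4) by blast
qed

text \<open>\<open>v\<close> and \<open>z\<close> exhaust the nonneighbours of \<open>x\<close>,
  while \<open>a\<close> is one of the two nonneighbours of \<open>q\<close>. The ways in which
  \<open>R\<close> can be entered then force a third nonneighbour on some vertex, a short cycle, or
  a set that no arc enters.\<close>

lemma core_contradiction:
  assumes q: "q \<in> Q1 v x y" and z: "z \<in> Z v x y" and qz: "E q z" and Nx: "nonadj x z"
  shows False
proof -
  note qD = Q1_D[OF q] and zD = Z_D[OF z]
  have new: "q \<noteq> v" "q \<noteq> a" "q \<noteq> b" "q \<noteq> x" "q \<noteq> y" "z \<noteq> v" "z \<noteq> a" "z \<noteq> b" "z \<noteq> x" "z \<noteq> y"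
    using Q_new[of q] Q_new[of z] qD zD by blast+
  have Nqa: "nonadj q a" using Q1_Na[OF q] nonadj_sym by blast
  have zV: "z \<in> V" and qV: "q \<in> V" using zD qD by blast+
  have xN: "u = z" if "u \<in> V" "u \<noteq> v" "nonadj x u" for u
    using N_eq[OF mem(4,1) zV arcs(7) Nx new(6)[symmetric] that(1,3)] that(2) by blast
  have yN: "u = s" if "s \<in> V" "s \<noteq> v" "nonadj y s" "u \<in> V" "u \<noteq> v" "nonadj y u" for s u
    using N_eq[OF mem(5,1) that(1) arcs(8) that(3) that(2)[symmetric] that(4,6)] that(5) by blast
  have x_adj: "E x u \<or> E u x" if "u \<in> V" "u \<noteq> x" "u \<noteq> v" "u \<noteq> z" for u
    using adjacent[OF mem(4,1) zV arcs(7) Nx new(6)[symmetric] that] .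
  have R1: "R v x y \<noteq> {}"
  proof
    assume "R v x y = {}"
    then have "card (R v x y) = 0" by simp
    then show False using card_parts card_Q1 card_Z by linarith
  qed
  have qr: "nonadj q r" if "r \<in> R v x y" "E z r" for r
  proof -
    have "q \<noteq> r" using that(1) q R_D[of r] Q1_D[of q] asym by blast
    then show ?thesis using R_not_from_Q1[OF q that(1)] no_triangle[OF qz that(2)] unfolding nonadj_def by blast
  qed
  \<comment> \<open>As soon as \<open>z\<close> has an arc to \<open>r\<close> in \<open>R\<close>,
    the nonneighbours of \<open>q\<close> are exactly \<open>a\<close> and \<open>r\<close>.\<close>
  have q_third: False if "r \<in> R v x y" "E z r" "u \<in> V" "nonadj q u" "u \<noteq> a" "u \<noteq> r" for r u
  proof -
    have "r \<in> V" "a \<noteq> r" using R_D[OF that(1)] Q_new by blast+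
    then show False using N_eq[OF qV mem(2) _ Nqa qr[OF that(1,2)] _ that(3,4)] that(5,6) by blast
  qed
  show False
  proof (cases "nonadj y z")
    case True
    \<comment> \<open>Here \<open>z\<close> uses up the free nonneighbour of both \<open>x\<close>
      and \<open>y\<close>. So \<open>R\<close> is entered from \<open>z\<close> alone, at a single
      \<open>r\<close>; all other vertices of \<open>R\<close> have arcs to \<open>z\<close>, and
      whatever enters \<open>R v x y - {r}\<close> closes a short cycle.\<close>
    have Z_eq: "Z v x y = {z}"
    proof (intro equalityI subsetI)
      fix u assume u: "u \<in> Z v x y"
      then have "u = z"
        using Z_D[OF u] Q_new[of u] xN[of u] yN[OF zV new(6) True, of u] by blast
      then show "u \<in> {z}" by simp
    qed (use z in simp)
    obtain r where r: "r \<in> R v x y" "E z r"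
      using R_entry[OF subset_refl R1] Z_eq by auto
    have nzr': "\<not> E z r'" if "r' \<in> R v x y" "r' \<noteq> r" for r'
    proof
      assume "E z r'"
      then have "nonadj q r'" using qr that by blast
      then show False using q_third[OF r, of r'] that R_D[of r'] Q_new[of r'] by blast
    qed
    have toz: "E r' z" if "r' \<in> R v x y" "r' \<noteq> r" for r'
    proof -
      have "nonadj z x" "nonadj z y" using Nx True nonadj_sym by blast+
      moreover have "r' \<noteq> z" using that z unfolding Z_def by blast
      ultimately show ?thesis
        using adjacent[OF zV mem(4,5) _ _ mem(6), of r'] R_D[OF that(1)] Q_new[of r'] nzr'[OF that] by blast
    qed
    have "2 \<le> card (R v x y)" using card_parts card_Q1 Z_eq by simp
    then have "R v x y - {r} \<noteq> {}"
      using card_mono[of "{r}" "R v x y"] by auto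
    then obtain u s where us: "u \<in> Z v x y \<or> u \<in> R v x y - (R v x y - {r})" "s \<in> R v x y - {r}" "E u s"
      using R_entry[OF Diff_subset] by metis
    then have "E s z" using toz by blast
    moreover have "u = z \<or> u = r" using us(1) Z_eq by blast
    ultimately show False using us(3) r(2) asym no_triangle by blast
  next
    case False
    then have zy: "E z y" using zD new unfolding nonadj_def by blast
    have nyq: "\<not> E y q" using no_triangle[OF qz zy] .
    then have xq: "E x q" using qD by blast
    have nyx: "\<not> E y x"
    proof
      assume yx: "E y x"
      have "\<not> E q y" using no_triangle[OF yx xq] by blast
      then have Nqy: "nonadj q y" using nyq new unfolding nonadj_def by blast
      have Z_eq: "\<forall>u\<in>Z v x y. u = z"
      proof
        fix u assume u: "u \<in> Z v x y"
        have "u \<noteq> q" using u q unfolding Z_def by blast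
        moreover have "nonadj y q" using Nqy nonadj_sym by blast
        ultimately show "u = z"
          using Z_D[OF u] Q_new[of u] xN[of u] yN[OF qV new(1), of u] by blast
      qed
      obtain r where "r \<in> R v x y" "E z r"
        using R_entry[OF subset_refl R1] Z_eq by auto
      then show False using q_third[of r y] Nqy mem(5) distinct_setting R_D[of r] Q_new[of r] by blast
    qed
    then have xy: "E x y" using x_adj[of y] mem distinct_setting new by blast
    have xQ1: "E x u" if "u \<in> Q1 v x y" for u
    proof -
      have "u \<noteq> z" "u \<noteq> x" "u \<noteq> v" using that z Q1_D[OF that] Q_new unfolding Z_def by blast+
      then have "E x u \<or> E u x" using x_adj Q1_D[OF that] by blast
      then show ?thesis using Q1_D[OF that] no_triangle[OF xy] by blast
    qed
    \<comment> \<open>Otherwise \<open>a\<close> and \<open>y\<close> are the out-neighbours of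
      \<open>b\<close>, and \<open>b \<rightarrow> a \<rightarrow> x \<rightarrow> b\<close> is a
      triangle.\<close>
    have bx: "E b x"
    proof (rule ccontr)
      assume nbx: "\<not> E b x"
      have "{u \<in> V. E b u} \<subseteq> {a, y}"
      proof
        fix u assume u: "u \<in> {u \<in> V. E b u}"
        then have "u \<noteq> v" "u \<noteq> b" "u \<noteq> x" "u \<notin> Q v" using nbx arcs(2) asym irrefl b_no_Q by blast+
        then show "u \<in> {a, y}" using u V_eq by blast
      qed
      then have "{u \<in> V. E b u} = {a, y}"
        using out2[OF mem(3)] distinct_setting(6) unfolding out_def by (intro card_seteq) auto
      then have "E b a" by blast
      moreover have "E x b" using x_adj[of b] mem distinct_setting new nbx by blast
      ultimately show False using no_triangle arcs(3) by blast
    qed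
    have NQ1b: "nonadj u b" "nonadj u a" if "u \<in> Q1 v x y" for u
    proof -
      have "u \<in> Q v" "u \<noteq> b" using Q1_D[OF that] Q_new by blast+
      then show "nonadj u b" using b_no_Q no_triangle[OF bx xQ1[OF that]] unfolding nonadj_def by blast
      show "nonadj u a" using Q1_Na[OF that] nonadj_sym by blast
    qed
    \<comment> \<open>Vertices of \<open>Q1\<close> have spent both nonneighbours on
      \<open>a\<close> and \<open>b\<close>.\<close>
    have Q1_adj: "E u t \<or> E t u" if "u \<in> Q1 v x y" "t \<in> Q v" "t \<noteq> u" for u t
    proof -
      have "t \<in> V" using that(2) unfolding Q_def by blast
      then show ?thesis
        using adjacent[OF _ mem(2,3) NQ1b(2,1)[OF that(1)] mem(7)] that Q1_D[OF that(1)] Q_new[OF that(2)] by blast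
    qed
    have nzR: "\<not> E z r" if "r \<in> R v x y" for r
      using q_third[OF that, of b] NQ1b[OF q] mem distinct_setting R_D[OF that] Q_new[of r] by blast
    obtain z2 r where z2: "z2 \<in> Z v x y" "r \<in> R v x y" "E z2 r"
      using R_entry[OF subset_refl R1] by blast
    have z2z: "z2 \<noteq> z" using nzR z2 by blast
    have "nonadj y z2"
      using Z_D[OF z2(1)] z2z xN[of z2] Q_new[of z2] by blast
    have Z2: "\<forall>u\<in>Z v x y. u = z \<or> u = z2"
    proof
      fix u assume u: "u \<in> Z v x y"
      have "z2 \<in> V" "z2 \<noteq> v" using Z_D[OF z2(1)] Q_new by blast+
      then show "u = z \<or> u = z2"
        using Z_D[OF u] Q_new[of u] xN[of u] yN[OF _ _ \<open>nonadj y z2\<close>, of u] by blast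
    qed
    have z2Q1: "E z2 u" if "u \<in> Q1 v x y" for u
    proof -
      have "u \<noteq> z2" using that z2 unfolding Z_def by blast
      have "r \<noteq> u" using that z2(2) R_D[OF z2(2)] Q1_D[OF that] asym by blast
      then have "E r u" using Q1_adj[OF that, of r] R_D[OF z2(2)] R_not_from_Q1[OF that z2(2)] by blast
      then have "\<not> E u z2" using no_triangle[OF z2(3)] by blast
      then show ?thesis using Q1_adj[OF that, of z2] Z_D[OF z2(1)] \<open>u \<noteq> z2\<close> by blast
    qed
    have nzz2: "\<not> E z z2" using no_triangle[OF qz] z2Q1[OF q] by blast
    \<comment> \<open>This set cannot be entered: \<open>x\<close>, \<open>y\<close>,
      \<open>Q1\<close> and \<open>z\<close> are all ruled out as tails.\<close>
    have "insert z2 (R v x y) \<subseteq> Q v" using z2 Z_D R_D by blast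
    then obtain u s where us: "u \<in> V" "u \<notin> insert z2 (R v x y)" "s \<in> insert z2 (R v x y)" "E u s"
       "u = x \<or> u = y \<or> u \<in> Q v"
      by (rule enter) blast
    have "u \<noteq> x" "u \<noteq> y" using us(3,4) Z_D[OF z2(1)] R_D asym by blast+
    then have "u \<in> Q1 v x y \<or> u = z" using us Q_cases Z2 by blast
    then show False
      using us(3,4) z2Q1 asym R_not_from_Q1 nzR nzz2 by blast
  qed
qed

end

lemma contradiction: False
proof -
  obtain v a b x y where S: "setting v a b x y" using exists_setting by blast
  note parts = card_parts[OF S] card_Q1[OF S] card_Z[OF S]
  \<comment> \<open>This union is entered only from \<open>Q1\<close>, and then at a vertex of
    \<open>Z\<close>, which is the configuration of \<open>core_contradiction\<close>.\<close>
  have "Z v x y \<union> R v x y \<noteq> {}" "Z v x y \<union> R v x y \<subseteq> Q v"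
    using parts(1,2) Z_D[OF S] R_D[OF S] by force+
  then obtain q z where qz: "q \<in> V" "q \<notin> Z v x y \<union> R v x y" "z \<in> Z v x y \<union> R v x y" "E q z" "q = x \<or> q = y \<or> q \<in> Q v"
    using enter[OF S] by metis
  have "q \<noteq> x" "q \<noteq> y" using qz(3,4) Z_D[OF S] R_D[OF S] asym by blast+
  then have q: "q \<in> Q1 v x y" using qz Q_cases[OF S] by blast
  then have z: "z \<in> Z v x y" using qz(3,4) R_not_from_Q1[OF S] by blast
  then consider "nonadj x z" | "nonadj y z" using Z_D[OF S] by blast
  then show False
  proof cases
    case 1
    then show False using core_contradiction[OF S q z qz(4)] by blast
  next
    case 2
    then show False using core_contradiction[OF setting_swap[OF S], of q z] q z qz(4)
      by (simp add: Q1_swap Z_swap)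
  qed
qed

end

section \<open>The bound on nonadjacent pairs and its relation to the arc count\<close>

lemma (in oriented) card_less_gap:
  assumes "finite V" "strong V" "10 \<le> card V" "\<And>v. v \<in> V \<Longrightarrow> 2 \<le> out V v"
  shows "card V + 1 \<le> gap V"
proof (rule ccontr)
  assume n: "\<not> card V + 1 \<le> gap V"
  have "V \<noteq> {}" using assms(3) by auto
  then have "\<forall>v\<in>V. card {y \<in> V. nonadj v y} = 2"
    using gap_ge_card[OF assms(1,2) _ assms(4)] rooted_bound n by blast
  then interpret two_gap_oriented E V using assms by unfold_locales auto
  show False by (rule contradiction)
qed

lemma (in oriented) twice_arcs:
  assumes "finite V"
  shows "2 * (\<Sum>x\<in>V. out V x) + 2 * gap V = card V * (card V - 1)"
proof -
  have "card V - 1 = out V x + card {y \<in> V. E y x} + card {y \<in> V. nonadj x y}" if "x \<in> V" for x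
  proof -
    have "V - {x} = {y \<in> V. E x y} \<union> ({y \<in> V. E y x} \<union> {y \<in> V. nonadj x y})"
      using irrefl unfolding nonadj_def by blast
    then have "card (V - {x}) = card ({y \<in> V. E x y} \<union> ({y \<in> V. E y x} \<union> {y \<in> V. nonadj x y}))"
      by simp
    also have "\<dots> = card {y \<in> V. E x y} + card ({y \<in> V. E y x} \<union> {y \<in> V. nonadj x y})"
      using assms asym by (intro card_Un_disjoint) (auto simp: nonadj_def)
    also have "card ({y \<in> V. E y x} \<union> {y \<in> V. nonadj x y}) = card {y \<in> V. E y x} + card {y \<in> V. nonadj x y}"
      using assms by (intro card_Un_disjoint) (auto simp: nonadj_def)
    finally show ?thesis using that by (simp add: out_def)
  qed
  then have "(\<Sum>x\<in>V. card V - 1) = (\<Sum>x\<in>V. out V x + card {y \<in> V. E y x} + card {y \<in> V. nonadj x y})"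
    by (intro sum.cong) auto
  then have "card V * (card V - 1) = (\<Sum>x\<in>V. out V x) + (\<Sum>x\<in>V. card {y \<in> V. E y x}) + 2 * gap V"
    using gap_double[OF assms] by (simp add: sum.distrib)
  moreover have "(\<Sum>x\<in>V. card {y \<in> V. E y x}) = (\<Sum>x\<in>V. out V x)"
  proof -
    have "(\<Sum>x\<in>V. card {y \<in> V. E y x}) = (\<Sum>x\<in>V. \<Sum>y\<in>V. if E y x then 1 else 0)"
      using assms by (simp add: sum.If_cases Int_def)
    also have "\<dots> = (\<Sum>y\<in>V. \<Sum>x\<in>V. if E y x then 1 else 0)"
      by (rule sum.swap)
    also have "\<dots> = (\<Sum>x\<in>V. out V x)"
      using assms by (simp add: out_def sum.If_cases Int_def)
    finally show ?thesis .
  qed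
  ultimately show ?thesis by simp
qed

section \<open>Digraphs\<close>

abbreviation adj :: "'a pair_pre_digraph \<Rightarrow> 'a \<Rightarrow> 'a \<Rightarrow> bool" where
  "adj D x y \<equiv> (x, y) \<in> parcs D"

text \<open>Links cycles given as arc lists with the two axioms of \<open>oriented\<close>;
  looplessness provides the distinct vertices of a cycle.\<close>

lemma (in pair_digraph) dicycle_free_3_iff_oriented:
  "dicycle_free_upto 3 G \<longleftrightarrow> oriented (adj G)"
proof
  assume free: "dicycle_free_upto 3 G"
  have no_cycle: False if "cycle p" "length p \<in> {2..3}" for p
    using free that unfolding dicycle_free_upto_def by blast
  have loop: "x \<noteq> y" if "adj G x y" for x y
    using pair_no_loops[OF that] by simp
  show "oriented (adj G)"
  proof
    fix x y assume xy: "adj G x y"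
    show "\<not> adj G y x"
    proof
      assume yx: "adj G y x"
      have "cycle [(x, y), (y, x)]"
        using xy yx loop[OF xy] in_arcsD1[OF xy] by (auto simp: cycle_def awalk_def)
      then show False using no_cycle by force
    qed
  next
    fix x y z assume a: "adj G x y" "adj G y z"
    show "\<not> adj G z x"
    proof
      assume zx: "adj G z x"
      have "cycle [(x, y), (y, z), (z, x)]" unfolding cycle_def
        using a zx loop[OF a(1)] loop[OF a(2)] loop[OF zx] in_arcsD1[OF a(1)]
        by (intro exI[of _ x]) (auto simp: awalk_def)
      then show False using no_cycle by force
    qed
  qed
next
  assume "oriented (adj G)"
  then interpret o: oriented "adj G" .
  show "dicycle_free_upto 3 G" unfolding dicycle_free_upto_def
  proof
    assume "\<exists>p. cycle p \<and> length p \<in> {2..3}"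
    then obtain p u where p: "length p = 2 \<or> length p = 3" "set p \<subseteq> parcs G" "pcas u p u"
      by (force simp: cycle_def awalk_def)
    from p(1) show False
    proof
      assume "length p = 2"
      then obtain e f where "p = [e, f]" by (auto simp: numeral_2_eq_2 length_Suc_conv)
      then show False using p(2,3) o.asym[of "fst e" "snd e"] by (cases e; cases f) auto
    next
      assume "length p = 3"
      then obtain e f g where "p = [e, f, g]" by (auto simp: numeral_3_eq_3 length_Suc_conv)
      then show False using p(2,3) o.no_triangle[of "fst e" "snd e" "snd f"]
        by (cases e; cases f; cases g) auto
    qed
  qed
qed

text \<open>The set of vertices reachable from \<open>u\<close> has no leaving arc. Nonemptiness is
  stated separately because \<open>strong\<close> also holds for the empty set.\<close>

lemma (in pair_digraph) strongly_connected_iff_strong: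
  assumes "oriented (adj G)"
  shows "strongly_connected (with_proj G) \<longleftrightarrow> pverts G \<noteq> {} \<and> oriented.strong (adj G) (pverts G)"
proof -
  interpret o: oriented "adj G" by (fact assms)
  have "o.strong (pverts G)" if "strongly_connected (with_proj G)" unfolding o.strong_def
  proof (intro allI impI, rule ccontr)
    fix S assume S: "S \<subseteq> pverts G \<and> S \<noteq> {} \<and> S \<noteq> pverts G"
      and closed: "\<not> (\<exists>x\<in>S. \<exists>y\<in>pverts G - S. adj G x y)"
    then obtain s t where st: "s \<in> S" "t \<in> pverts G" "t \<notin> S" by blast
    then have "s \<rightarrow>\<^sup>*\<^bsub>with_proj G\<^esub> t" using that S unfolding strongly_connected_def by auto
    then have "t \<in> S"
    proof (induction rule: reachable_induct)
      case base
      show ?case by (fact st)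
    next
      case (step x y)
      then have "adj G x y" by simp
      then show ?case using closed in_arcsD2[of x y] step.IH by blast
    qed
    then show False using st by blast
  qed
  moreover have "strongly_connected (with_proj G)"
    if ne: "pverts G \<noteq> {}" and strong: "o.strong (pverts G)"
  proof
    show "verts (with_proj G) \<noteq> {}" using ne by simp
    fix u v assume "u \<in> verts (with_proj G)" and v: "v \<in> verts (with_proj G)"
    then have u: "u \<in> pverts G" by simp
    let ?S = "{w \<in> pverts G. u \<rightarrow>\<^sup>*\<^bsub>with_proj G\<^esub> w}"
    have "?S = pverts G"
    proof (rule ccontr)
      assume "?S \<noteq> pverts G"
      moreover have "u \<in> ?S" using u by simp
      ultimately obtain x y where "x \<in> ?S" "y \<in> pverts G" "y \<notin> ?S" "adj G x y"
        using o.strongD[OF strong, of ?S] by blast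
      then show False using reachable_adj_trans[of u x y] by simp
    qed
    then show "u \<rightarrow>\<^sup>*\<^bsub>with_proj G\<^esub> v" using v by auto
  qed
  ultimately show ?thesis unfolding strongly_connected_def by auto
qed

lemma (in pair_digraph) out_degree_eq_out:
  assumes "oriented (adj G)"
  shows "out_degree (with_proj G) x = oriented.out (adj G) (pverts G) x"
proof -
  have "bij_betw snd (out_arcs (with_proj G) x) {y \<in> pverts G. adj G x y}"
    by (rule bij_betwI[where g = "\<lambda>y. (x, y)"]) (auto simp: out_arcs_def in_arcsD2)
  then show ?thesis
    unfolding out_degree_def oriented.out_def[OF assms] by (rule bij_betw_same_card)
qed

lemma (in pair_digraph) card_parcs_eq_sum_out:
  assumes "oriented (adj G)"
  shows "card (parcs G) = (\<Sum>x\<in>pverts G. oriented.out (adj G) (pverts G) x)"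
proof -
  have "parcs G = Sigma (pverts G) (\<lambda>x. {y \<in> pverts G. adj G x y})"
    using in_arcsD1 in_arcsD2 by auto
  then have "card (parcs G) = card (Sigma (pverts G) (\<lambda>x. {y \<in> pverts G. adj G x y}))" by simp
  then show ?thesis using pair_finite_verts by (simp add: oriented.out_def[OF assms])
qed

text \<open>Since \<open>n * (n - 1) = (n - 1) * (n - 2) + 2 * (n - 1)\<close>, the arc count is
  \<open>((n - 1) choose 2) + (n - 1) - g\<close>, and \<open>g = n + 1\<close> leaves the summand
  -2.\<close>

lemma choose_two_minus_two:
  assumes "10 \<le> n" "2 * A + 2 * g = n * (n - 1)"
  shows "n + 1 \<le> g \<Longrightarrow> A \<le> ((n - 1) choose 2) - 2"
    and "g = n + 1 \<Longrightarrow> A = ((n - 1) choose 2) - 2"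
proof -
  obtain k where k: "n = k + 10" using assms(1) by (metis add.commute le_Suc_ex)
  have c: "2 * ((n - 1) choose 2) = (n - 1) * (n - 2)"
    by (simp add: choose_two k)
  have e: "(n - 1) * (n - 2) + 2 * (n - 1) = n * (n - 1)"
    unfolding k by (simp add: algebra_simps)
  show "n + 1 \<le> g \<Longrightarrow> A \<le> ((n - 1) choose 2) - 2"
    using c e assms by linarith
  show "g = n + 1 \<Longrightarrow> A = ((n - 1) choose 2) - 2"
    using c e assms by linarith
qed

lemma card_parcs_le:
  assumes n: "10 \<le> n" and D: "D \<in> digraph_family n 3 2 1"
  shows "card (parcs D) \<le> ((n - 1) choose 2) - 2"
proof -
  have pd: "pair_digraph D" and c: "card (pverts D) = n"
    and sc: "strongly_connected (with_proj D)" and fr: "dicycle_free_upto 3 D"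
    and deg: "\<And>v. v \<in> pverts D \<Longrightarrow> 2 \<le> out_degree (with_proj D) v"
    using D unfolding digraph_family_def by auto
  interpret pair_digraph D by (fact pd)
  have or: "oriented (adj D)" using fr dicycle_free_3_iff_oriented by blast
  interpret o: oriented "adj D" by (fact or)
  have "n + 1 \<le> o.gap (pverts D)"
    using o.card_less_gap[OF pair_finite_verts] strongly_connected_iff_strong[OF or] sc deg n c
    by (simp add: out_degree_eq_out[OF or])
  then show ?thesis
    using choose_two_minus_two(1)[OF n] o.twice_arcs[OF pair_finite_verts] c
    by (simp add: card_parcs_eq_sum_out[OF or])
qed

text \<open>
  The extremal digraph arises from a digraph on the vertices \<open>0, \<dots>, 8\<close> in which vertex 8 has a single
  nonneighbour, by blowing up vertex 8 into a transitive tournament on \<open>8, \<dots>, n - 1\<close>. Each new vertex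
  adds exactly one nonadjacent pair.
\<close>

definition succs :: "nat \<Rightarrow> nat set" where
  "succs i = (if 8 \<le> i then {1, 2, 3, 4, 5, 7} \<union> {i<..}
     else [{1, 2, 6}, {4, 5}, {1, 4}, {0, 2}, {5, 7}, {3, 7}, {1, 2, 4, 5} \<union> {8..}, {0, 3}] ! i)"

definition extremal :: "nat \<Rightarrow> nat pair_pre_digraph" where
  "extremal n = \<lparr> pverts = {..<n}, parcs = Sigma {..<n} (\<lambda>i. succs i \<inter> {..<n}) \<rparr>"

section \<open>The extremal digraph\<close>

lemma succs_simps:
  "succs 0 = {1, 2, 6}" "succs 1 = {4, 5}" "succs (Suc 0) = {4, 5}" "succs 2 = {1, 4}" "succs 3 = {0, 2}"
  "succs 4 = {5, 7}" "succs 5 = {3, 7}" "succs 6 = {1, 2, 4, 5} \<union> {8..}" "succs 7 = {0, 3}"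
  "8 \<le> i \<Longrightarrow> succs i = {1, 2, 3, 4, 5, 7} \<union> {i<..}"
  by (simp_all add: succs_def numeral_eq_Suc)

lemma vertex_cases:
  obtains "i = 0" | "i = 1" | "i = 2" | "i = 3" | "i = 4" | "i = 5" | "i = 6" | "i = 7" | "8 \<le> (i::nat)"
proof (cases "8 \<le> i")
  case False
  then have "i \<in> {..<8}" by simp
  then show thesis using that by (simp add: lessThan_nat_numeral lessThan_Suc) blast
qed (use that in blast)

lemma succs_asym: "j \<in> succs i \<Longrightarrow> i \<notin> succs j"
  by (cases i rule: vertex_cases) (auto simp: succs_simps)

lemma succs_no_triangle: "j \<in> succs i \<Longrightarrow> k \<in> succs j \<Longrightarrow> i \<notin> succs k"
  by (cases i rule: vertex_cases) (auto simp: succs_simps)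

lemma oriented_extremal: "oriented (adj (extremal n))"
proof
  fix x y z
  show "adj (extremal n) x y \<Longrightarrow> \<not> adj (extremal n) y x"
    using succs_asym[of y x] by (auto simp: extremal_def)
  show "adj (extremal n) x y \<Longrightarrow> adj (extremal n) y z \<Longrightarrow> \<not> adj (extremal n) z x"
    using succs_no_triangle[of y x z] by (auto simp: extremal_def)
qed

lemma pair_digraph_extremal: "pair_digraph (extremal n)"
proof
  show "fst e \<noteq> snd e" if "e \<in> parcs (extremal n)" for e
    using that succs_asym[of "snd e" "fst e"] by (auto simp: extremal_def)
qed (auto simp: extremal_def)

lemma out_extremal:
  assumes "i < n"
  shows "oriented.out (adj (extremal n)) {..<n} i = card (succs i \<inter> {..<n})"
  unfolding oriented.out_def[OF oriented_extremal]
  using assms by (auto simp: extremal_def intro!: arg_cong[where f = card])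

lemma card_succs:
  assumes "10 \<le> n"
  shows "card (succs 0 \<inter> {..<n}) = 3" "i \<in> {1, 2, 3, 4, 5, 7} \<Longrightarrow> card (succs i \<inter> {..<n}) = 2"
    "card (succs 6 \<inter> {..<n}) = n - 4" "8 \<le> i \<Longrightarrow> i < n \<Longrightarrow> card (succs i \<inter> {..<n}) = 6 + (n - 1 - i)"
proof -
  show "card (succs 0 \<inter> {..<n}) = 3"
    using assms by (simp add: succs_simps Int_insert_left)
  show "card (succs i \<inter> {..<n}) = 2" if "i \<in> {1, 2, 3, 4, 5, 7}"
    using that assms by (elim insertE emptyE) (simp_all add: succs_simps Int_insert_left)
  have "succs 6 \<inter> {..<n} = {1, 2, 4, 5} \<union> {8..<n}" using assms by (auto simp: succs_simps)
  then show "card (succs 6 \<inter> {..<n}) = n - 4"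
    using assms by (simp add: card_Un_disjoint)
  assume i: "8 \<le> i" "i < n"
  then have "succs i \<inter> {..<n} = {1, 2, 3, 4, 5, 7} \<union> {i<..<n}" using assms by (auto simp: succs_simps)
  then show "card (succs i \<inter> {..<n}) = 6 + (n - 1 - i)"
    using i by (simp add: card_Un_disjoint)
qed

text \<open>From every vertex a path leads to 0; from 0 one reaches 6, then all vertices from 8 on,
  and 8 has arcs to all the remaining ones.\<close>

lemma strong_extremal:
  assumes n: "10 \<le> n"
  shows "oriented.strong (adj (extremal n)) {..<n}"
  unfolding oriented.strong_def[OF oriented_extremal]
proof (intro allI impI, rule ccontr)
  fix S assume S: "S \<subseteq> {..<n} \<and> S \<noteq> {} \<and> S \<noteq> {..<n}"
    and no_exit: "\<not> (\<exists>x\<in>S. \<exists>y\<in>{..<n} - S. adj (extremal n) x y)"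
  have closed: "y \<in> S" if "x \<in> S" "y \<in> succs x" "y < n" for x y
  proof -
    have "adj (extremal n) x y" using that S by (auto simp: extremal_def)
    with no_exit that show ?thesis by blast
  qed
  have step: "0 \<in> S" if "3 \<in> S \<or> 7 \<in> S"
    using that closed[of 3 0] closed[of 7 0] n by (auto simp: succs_simps)
  have step2: "0 \<in> S" if "4 \<in> S \<or> 5 \<in> S"
    using that closed[of 4 7] closed[of 5 7] step n by (auto simp: succs_simps)
  have step3: "0 \<in> S" if "1 \<in> S" using that closed[of 1 4] step2 n by (auto simp: succs_simps)
  obtain s where s: "s \<in> S" using S by blast
  have "0 \<in> S"
  proof (cases s rule: vertex_cases)
    \<comment> \<open>The case numbers follow \<open>vertex_cases\<close>: 9 stands for
      \<open>8 \<le> s\<close>, 3 for \<open>s = 2\<close> and 7 for \<open>s = 6\<close>.\<close>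
    case 9
    then show ?thesis using closed[OF s, of 3] step n by (auto simp: succs_simps)
  next
    case 3
    then show ?thesis using closed[OF s, of 1] step3 n by (auto simp: succs_simps)
  next
    case 7
    then show ?thesis using closed[OF s, of 1] step3 n by (auto simp: succs_simps)
  qed (use s step step2 step3 in auto)
  then have "6 \<in> S" using closed[of 0 6] n by (auto simp: succs_simps)
  then have ge8: "i \<in> S" if "8 \<le> i" "i < n" for i
    using closed[of 6 i] that by (auto simp: succs_simps)
  have "i \<in> S" if i: "i < n" for i
  proof (cases "i = 0 \<or> i = 6 \<or> 8 \<le> i")
    case True
    then show ?thesis using \<open>0 \<in> S\<close> \<open>6 \<in> S\<close> ge8 i by blast
  next
    case False
    then have "i \<in> succs 8" by (auto simp: succs_simps)
    then show ?thesis using closed[OF ge8[of 8]] i n by auto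
  qed
  then show False using S by auto
qed

lemma extremal_in_family:
  assumes n: "10 \<le> n"
  shows "extremal n \<in> digraph_family n 3 2 1"
proof -
  interpret pair_digraph "extremal n" by (rule pair_digraph_extremal)
  interpret o: oriented "adj (extremal n)" by (rule oriented_extremal)
  have pv: "pverts (extremal n) = {..<n}" by (simp add: extremal_def)
  have "{..<n} \<noteq> {}" using n by (auto simp: lessThan_empty_iff)
  have "2 \<le> out_degree (with_proj (extremal n)) v" if v: "v < n" for v
  proof -
    have "2 \<le> card (succs v \<inter> {..<n})"
      using n v card_succs[OF n] by (cases v rule: vertex_cases) auto
    then show ?thesis using out_extremal[OF v] out_degree_eq_out[OF oriented_extremal] pv by simp
  qed
  moreover have "1 \<le> in_degree (with_proj (extremal n)) v" if v: "v < n" for v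
  proof -
    have "{..<n} \<noteq> {v}" using n v by (auto dest!: arg_cong[where f = card])
    then obtain u where "u < n" "adj (extremal n) u v"
      using o.strong_in_neighbour[OF strong_extremal[OF n], of v] v by auto
    then have "(u, v) \<in> in_arcs (with_proj (extremal n)) v" by (simp add: in_arcs_def)
    moreover have "finite (in_arcs (with_proj (extremal n)) v)"
      using pair_finite_arcs by (simp add: in_arcs_def)
    ultimately show ?thesis
      unfolding in_degree_def by (metis One_nat_def Suc_leI card_gt_0_iff empty_iff)
  qed
  moreover have "strongly_connected (with_proj (extremal n))"
    using strongly_connected_iff_strong[OF oriented_extremal] strong_extremal[OF n] pv \<open>{..<n} \<noteq> {}\<close>
    by simp
  moreover have "dicycle_free_upto 3 (extremal n)"
    using dicycle_free_3_iff_oriented oriented_extremal by blast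
  ultimately show ?thesis
    unfolding digraph_family_def using pair_digraph_extremal pv by simp
qed

lemma card_parcs_extremal:
  assumes n: "10 \<le> n"
  shows "card (parcs (extremal n)) = ((n - 1) choose 2) - 2"
proof -
  interpret pair_digraph "extremal n" by (rule pair_digraph_extremal)
  have pv: "pverts (extremal n) = {..<n}" by (simp add: extremal_def)
  obtain m where m: "n = m + 8" using n by (metis add.commute le_Suc_ex le_trans numeral_le_iff semiring_norm(69,71,72,68))
  let ?c = "\<lambda>i. card (succs i \<inter> {..<n})"
  have "card (parcs (extremal n)) = (\<Sum>i<n. ?c i)"
    using card_parcs_eq_sum_out[OF oriented_extremal] pv out_extremal by simp
  also have "\<dots> = (\<Sum>i<8. ?c i) + (\<Sum>i=8..<n. ?c i)"
    using n by (metis (no_types, lifting) sum.atLeastLessThan_concat atLeast0LessThan le_trans numeral_le_iff semiring_norm(68,69,71,72) zero_le)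
  \<comment> \<open>Vertex 0 contributes 3, the vertices 1, 2, 3, 4, 5, 7 contribute 2 each, and
    vertex 6 contributes \<open>n - 4 = m + 4\<close>.\<close>
  also have "(\<Sum>i<8. ?c i) = 19 + m"
    using card_succs[OF n] m by (simp add: lessThan_nat_numeral)
  also have "(\<Sum>i=8..<n. ?c i) = (\<Sum>i=8..<n. 6 + (n - 1 - i))"
    using card_succs(4)[OF n] by (intro sum.cong) auto
  also have "\<dots> = (\<Sum>i<m. 6 + (m - Suc i))"
    by (rule sum.reindex_bij_witness[of _ "\<lambda>i. i + 8" "\<lambda>i. i - 8"]) (auto simp: m)
  also have "\<dots> = (\<Sum>i<m. 6 + i)"
    by (rule sum.nat_diff_reindex)
  finally have "card (parcs (extremal n)) = 19 + m + (\<Sum>i<m. 6 + i)" .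
  moreover have "2 * (\<Sum>i<m. 6 + i) = 11 * m + m * m"
    by (induction m) (auto simp: algebra_simps)
  ultimately have "2 * card (parcs (extremal n)) = 38 + 13 * m + m * m" by simp
  \<comment> \<open>Puts the count into the form of \<open>choose_two_minus_two\<close> with
    \<open>g = n + 1\<close>, the least possible gap.\<close>
  moreover have "2 * (n + 1) + (38 + 13 * m + m * m) = n * (n - 1)"
    unfolding m by (simp add: algebra_simps)
  ultimately have "2 * card (parcs (extremal n)) + 2 * (n + 1) = n * (n - 1)" by simp
  then show ?thesis by (rule choose_two_minus_two(2)[OF n]) simp
qed

theorem theorem1p6:
  fixes n :: nat
  assumes "n \<ge> 10"
  shows "max_arcs n 3 2 1 = ((n - 1) choose 2) - 2"
proof -
  have "Max ((\<lambda>D. card (parcs D)) ` digraph_family n 3 2 1) = ((n - 1) choose 2) - 2"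
    using finite_arc_counts
  proof (rule Max_eqI)
    show "((n - 1) choose 2) - 2 \<in> (\<lambda>D. card (parcs D)) ` digraph_family n 3 2 1"
      using extremal_in_family[OF assms] card_parcs_extremal[OF assms] by force
  qed (use card_parcs_le[OF assms] in blast)
  then show ?thesis
    unfolding max_arcs_def using extremal_in_family[OF assms] by auto
qed

end
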